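(* Let $n\ge1$. If $f(x_1,\dots,x_n;\mathbf t)\in\mathrm{EQSym}_n$ and $\sigma\in\mathrm{NC}_n$, then $\mathrm{ev}_\sigma f=\mathrm{ev}_{\mathrm{id}}f$. In particular, if $c$ is a nonempty padded composition of length $n$ (i.e. $c\neq(0^n)$), then $\mathrm{ev}_\sigma\mathfrak F_c=0$ for all $\sigma\in\mathrm{NC}_n$.
   Context: $\mathbf x=(x_1,x_2,\dots)$, $\mathbf t=(t_1,t_2,\dots)$. For $f\in\mathbb Z[\mathbf t][\mathbf x]$: $R_i^-f=f(x_1,\dots,x_{i-1},t_i,x_i,\dots;\mathbf t)$, $R_i^+f=f(x_1,\dots,x_i,t_i,x_{i+1},\dots;\mathbf t)$, $E_if=(R_i^+f-R_i^-f)/(x_i-t_i)$. $\mathrm{EQSym}_n=\{f\in\mathbb Z[\mathbf t][x_1,\dots,x_n]:R_i^+f=R_i^-f\text{ for }1\le i<n\}$. For a permutation $\sigma$, $\mathrm{ev}_\sigma f=f(t_{\sigma(1)},t_{\sigma(2)},\dots;\mathbf t)$. Noncrossing permutations: a set partition of $[n]$ is noncrossing if there are no distinct blocks $P,Q$ with $a,b\in P$, $c,d\in Q$ and $a<c<b<d$. To such a partition associate the permutation $\sigma\in S_n$ which on each block $\{a_1<\dots<a_p\}$ acts by $\sigma(a_j)=a_{j-1}$ for $j\ge2$ and $\sigma(a_1)=a_p$ (the cycle $(a_p\,a_{p-1}\cdots a_1)$). $\mathrm{NC}_n\subseteq S_n$ is the set of these permutations. Double fundamental polynomials: indexed forests are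 sequences $F=(T_1,T_2,\dots)$ of binary plane trees (each node a leaf or an internal node with ordered left/right children), all but finitely many being one-node trees, with leaves identified with $\mathbb N$ left to right; $\emptyset$ has no internal nodes; $\rho_F(v)$ is the leaf reached from internal node $v$ by repeatedly going to left children; a node is terminal if both children are leaves; $\mathrm{Qdes}(F)=\{\rho_F(v):v\text{ terminal}\}$; $F/i$ deletes the terminal node with $\rho_F(v)=i$ (replacing it and its leaves by one leaf, relabeling). The double forest polynomials $\mathfrak P_F(\mathbf x;\mathbf t)$ are the unique homogeneous family ($\deg x_i=\deg t_i=1$) with $\mathfrak P_F(\mathbf t;\mathbf t)=\delta_{F,\emptyset}$ and $E_i\mathfrak P_F=\mathfrak P_{F/i}(\mathbf x;\widehat{\mathbf t}_i)$ if $i\in\mathrm{Qdes}(F)$, else $0$, with $\widehat{\mathbf t}_i=(t_1,\dots,t_{i-1},t_{i+1},\dots)$. The code of $F$ is $(c_i)$ with $c_i=\#\{v:\rho_F(v)=i\}$. A padded composition of length $n$ is $c=(0^{n-\ell},a_1,\dots,a_\ell)$, $\ell\ge0$, $a_i>0$; $F_c$ is the forest with code $c$ (followed by zeros) and $\mathfrak F_c(x_1,\dots,x_n;\mathbf t):=\mathfrak P_{F_c}(\mathbf x;\mathbf t)$, which lies in $\mathrm{EQSym}_n$. *)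

theory Defs
  imports Main "HOL-Library.Multiset" "HOL-Library.Poly_Mapping" "HOL-Library.Disjoint_Sets"
begin

text \<open>Variables: X i stands for x_i and T i for t_i (indices start at 1; index 0 is unused).\<close>
datatype var = X nat | T nat

type_synonym poly = "(var \<Rightarrow>\<^sub>0 nat) \<Rightarrow>\<^sub>0 int"

definition Var :: "var \<Rightarrow> poly" where
  "Var v = Poly_Mapping.single (Poly_Mapping.single v 1) 1"

definition vars :: "poly \<Rightarrow> var set" where
  "vars p = (\<Union>m\<in>Poly_Mapping.keys p. Poly_Mapping.keys m)"

definition subst :: "(var \<Rightarrow> poly) \<Rightarrow> poly \<Rightarrow> poly" where
  "subst s p = (\<Sum>m\<in>Poly_Mapping.keys p.
      of_int (Poly_Mapping.lookup p m) * (\<Prod>v\<in>Poly_Mapping.keys m. s v ^ Poly_Mapping.lookup m v))"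

definition homogeneous :: "poly \<Rightarrow> bool" where
  "homogeneous p = (\<exists>d. \<forall>m\<in>Poly_Mapping.keys p. (\<Sum>v\<in>Poly_Mapping.keys m. Poly_Mapping.lookup m v) = d)"

definition Rminus :: "nat \<Rightarrow> poly \<Rightarrow> poly" where
  "Rminus i = subst (\<lambda>v. case v of
      X j \<Rightarrow> (if j < i then Var (X j) else if j = i then Var (T i) else Var (X (j - 1)))
    | T j \<Rightarrow> Var (T j))"

definition Rplus :: "nat \<Rightarrow> poly \<Rightarrow> poly" where
  "Rplus i = subst (\<lambda>v. case v of
      X j \<Rightarrow> (if j \<le> i then Var (X j) else if j = i + 1 then Var (T i) else Var (X (j - 1)))
    | T j \<Rightarrow> Var (T j))"

definition Ediv :: "nat \<Rightarrow> poly \<Rightarrow> poly" where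
  "Ediv i f = (THE g. Rplus i f - Rminus i f = (Var (X i) - Var (T i)) * g)"

definition poly_xn :: "nat \<Rightarrow> poly set" where
  "poly_xn n = {p. vars p \<subseteq> {X i | i. 1 \<le> i \<and> i \<le> n} \<union> {T j | j. 1 \<le> j}}"

definition poly_x :: "poly set" where
  "poly_x = {p. vars p \<subseteq> {X i | i. 1 \<le> i} \<union> {T j | j. 1 \<le> j}}"

definition EQSym :: "nat \<Rightarrow> poly set" where
  "EQSym n = {f \<in> poly_xn n. \<forall>i. 1 \<le> i \<and> i < n \<longrightarrow> Rplus i f = Rminus i f}"

definition ev :: "(nat \<Rightarrow> nat) \<Rightarrow> poly \<Rightarrow> poly" where
  "ev \<sigma> = subst (\<lambda>v. case v of X j \<Rightarrow> Var (T (\<sigma> j)) | T j \<Rightarrow> Var (T j))"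

definition noncrossing :: "nat set set \<Rightarrow> bool" where
  "noncrossing P = (\<forall>B\<in>P. \<forall>C\<in>P. B \<noteq> C \<longrightarrow>
     \<not> (\<exists>a b c d. a \<in> B \<and> b \<in> B \<and> c \<in> C \<and> d \<in> C \<and> a < c \<and> c < b \<and> b < d))"

definition perm_of_partition :: "nat set set \<Rightarrow> nat \<Rightarrow> nat" where
  "perm_of_partition P a =
    (if \<exists>B\<in>P. a \<in> B then
       (let B = (THE B. B \<in> P \<and> a \<in> B) in
          if \<exists>b\<in>B. b < a then Max {b\<in>B. b < a} else Max B)
     else a)"

definition NC :: "nat \<Rightarrow> (nat \<Rightarrow> nat) set" where
  "NC n = {perm_of_partition P | P. partition_on {1..n} P \<and> noncrossing P}"

datatype tree = Lf | Nd tree tree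

fun nleaves :: "tree \<Rightarrow> nat" where
  "nleaves Lf = 1"
| "nleaves (Nd l r) = nleaves l + nleaves r"

text \<open>An indexed forest is a sequence T_1 = F 0, T_2 = F 1, ... of binary plane trees,
  all but finitely many being single leaves.\<close>
definition indexed_forest :: "(nat \<Rightarrow> tree) \<Rightarrow> bool" where
  "indexed_forest F = finite {k. F k \<noteq> Lf}"

definition empty_forest :: "nat \<Rightarrow> tree" where
  "empty_forest = (\<lambda>k. Lf)"

text \<open>Label of the leftmost leaf of tree number k (leaves labelled 1,2,... left to right).\<close>
definition offset :: "(nat \<Rightarrow> tree) \<Rightarrow> nat \<Rightarrow> nat" where
  "offset F k = 1 + (\<Sum>j<k. nleaves (F j))"

text \<open>Multiset of values rho(v) over internal nodes v of a tree whose leftmost leaf is a.\<close>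
fun rhos :: "nat \<Rightarrow> tree \<Rightarrow> nat multiset" where
  "rhos a Lf = {#}"
| "rhos a (Nd l r) = {#a#} + rhos a l + rhos (a + nleaves l) r"

definition code :: "(nat \<Rightarrow> tree) \<Rightarrow> nat \<Rightarrow> nat" where
  "code F i = (\<Sum>k\<in>{k. F k \<noteq> Lf}. count (rhos (offset F k) (F k)) i)"

fun terms :: "nat \<Rightarrow> tree \<Rightarrow> nat set" where
  "terms a Lf = {}"
| "terms a (Nd Lf Lf) = {a}"
| "terms a (Nd l r) = terms a l \<union> terms (a + nleaves l) r"

definition Qdes :: "(nat \<Rightarrow> tree) \<Rightarrow> nat set" where
  "Qdes F = (\<Union>k. terms (offset F k) (F k))"

fun contract :: "nat \<Rightarrow> nat \<Rightarrow> tree \<Rightarrow> tree" where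
  "contract a i Lf = Lf"
| "contract a i (Nd Lf Lf) = (if a = i then Lf else Nd Lf Lf)"
| "contract a i (Nd l r) = Nd (contract a i l) (contract (a + nleaves l) i r)"

definition forest_quot :: "(nat \<Rightarrow> tree) \<Rightarrow> nat \<Rightarrow> (nat \<Rightarrow> tree)" where
  "forest_quot F i = (\<lambda>k. contract (offset F k) i (F k))"

definition eval_tt :: "poly \<Rightarrow> poly" where
  "eval_tt = subst (\<lambda>v. case v of X j \<Rightarrow> Var (T j) | T j \<Rightarrow> Var (T j))"

definition that :: "nat \<Rightarrow> poly \<Rightarrow> poly" where
  "that i = subst (\<lambda>v. case v of X j \<Rightarrow> Var (X j)
                              | T j \<Rightarrow> (if j < i then Var (T j) else Var (T (j + 1))))"

definition forest_poly_family :: "((nat \<Rightarrow> tree) \<Rightarrow> poly) \<Rightarrow> bool" where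
  "forest_poly_family P =
    (\<forall>F. indexed_forest F \<longrightarrow>
        P F \<in> poly_x \<and> homogeneous (P F)
      \<and> eval_tt (P F) = (if F = empty_forest then 1 else 0)
      \<and> (\<forall>i\<ge>1. Ediv i (P F) = (if i \<in> Qdes F then that i (P (forest_quot F i)) else 0)))"

definition forest_poly :: "(nat \<Rightarrow> tree) \<Rightarrow> poly" where
  "forest_poly F = (THE p. \<exists>P. forest_poly_family P \<and> p = P F)"

definition padded_comp :: "nat \<Rightarrow> nat list \<Rightarrow> bool" where
  "padded_comp n c = (length c = n \<and>
     (\<exists>k\<le>n. (\<forall>i<k. c ! i = 0) \<and> (\<forall>i. k \<le> i \<and> i < n \<longrightarrow> c ! i > 0)))"

definition forest_of_code :: "nat list \<Rightarrow> (nat \<Rightarrow> tree)" where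
  "forest_of_code c = (THE F. indexed_forest F \<and>
      code F = (\<lambda>i. if 1 \<le> i \<and> i \<le> length c then c ! (i - 1) else 0))"

definition FF :: "nat list \<Rightarrow> poly" where
  "FF c = forest_poly (forest_of_code c)"

end

theory Submission
  imports Defs
begin

text \<open>
  \<^emph>\<open>Evaluations.\<close> Equivariant quasisymmetry says that in \<open>f(b\<^sub>1, \<dots>, b\<^sub>n)\<close> the entries \<open>b\<^sub>i\<close> and
  \<open>b\<^sub>i\<^sub>+\<^sub>1\<close> may be swapped whenever \<open>b\<^sub>i = t\<^sub>i\<close>. In a noncrossing partition choose \<open>a < b\<close> in a common
  block with \<open>b - a\<close> minimal; everything in between is a singleton block, and a chain of such swaps
  splits \<open>a\<close> off its block. Iterating reaches the identity.

  \<^emph>\<open>Double fundamentals.\<close> The forest \<open>F\<^sub>c\<close> of a nonzero padded composition of length \<open>n\<close> has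
  \<open>Qdes F\<^sub>c \<subseteq> {n}\<close>, so \<open>E\<^sub>i\<close> kills its polynomial for \<open>i \<noteq> n\<close>, which puts it in \<open>EQSym\<^sub>n\<close>. Since the
  forest polynomials are given by a description, one has to know that they exist. They are built by
  recursion on the number of nodes from a Poincare lemma: a finitely supported family
  \<open>g\<^sub>i\<close> satisfying the commutation relations of the \<open>E\<^sub>i\<close> has the form \<open>g\<^sub>i = E\<^sub>i f\<close>. At \<open>t = 0\<close> there
  is an explicit solution by telescoping, and for general \<open>t\<close> the same formula is correct up to
  terms of higher degree in \<open>t\<close>, so that it can be corrected step by step.
\<close>

section \<open>Substitution\<close>

abbreviation lookup where "lookup \<equiv> Poly_Mapping.lookup"
abbreviation keys where "keys \<equiv> Poly_Mapping.keys"
abbreviation single where "single \<equiv> Poly_Mapping.single"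

definition mon_subst :: "(var \<Rightarrow> poly) \<Rightarrow> (var \<Rightarrow>\<^sub>0 nat) \<Rightarrow> poly" where
  "mon_subst s m = (\<Prod>v\<in>keys m. s v ^ lookup m v)"

lemma mon_subst_superset:
  assumes "finite A" "keys m \<subseteq> A"
  shows "mon_subst s m = (\<Prod>v\<in>A. s v ^ lookup m v)"
  unfolding mon_subst_def
  by (rule prod.mono_neutral_left) (use assms in \<open>auto simp: in_keys_iff\<close>)

lemma mon_subst_0 [simp]: "mon_subst s 0 = 1"
  by (simp add: mon_subst_def)

lemma mon_subst_add: "mon_subst s (m + m') = mon_subst s m * mon_subst s m'"
proof -
  let ?A = "keys m \<union> keys m'"
  have "mon_subst s (m + m') = (\<Prod>v\<in>?A. s v ^ lookup (m + m') v)"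
    by (rule mon_subst_superset) (auto dest: subsetD[OF Poly_Mapping.keys_add])
  also have "\<dots> = (\<Prod>v\<in>?A. s v ^ lookup m v) * (\<Prod>v\<in>?A. s v ^ lookup m' v)"
    by (simp add: lookup_add power_add prod.distrib)
  also have "\<dots> = mon_subst s m * mon_subst s m'"
    by (simp add: mon_subst_superset[where A = ?A])
  finally show ?thesis .
qed

lemma mon_subst_single [simp]: "mon_subst s (single v k) = s v ^ k"
  by (cases "k = 0") (simp_all add: mon_subst_def)

lemma subst_alt: "subst s p = (\<Sum>m\<in>keys p. of_int (lookup p m) * mon_subst s m)"
  by (simp add: subst_def mon_subst_def)

lemma subst_0 [simp]: "subst s 0 = 0"
  by (simp add: subst_alt)

lemma subst_add [simp]: "subst s (p + q) = subst s p + subst s q"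
  unfolding subst_alt
  by (rule setsum_keys_plus_distrib) (simp_all add: distrib_right)

lemma subst_single: "subst s (single m c) = of_int c * mon_subst s m"
  by (cases "c = 0") (simp_all add: subst_alt)

lemma subst_uminus [simp]: "subst s (- p) = - subst s p"
  using subst_add[of s p "- p"] by (simp add: add_eq_0_iff)

lemma subst_diff [simp]: "subst s (p - q) = subst s p - subst s q"
  using subst_add[of s p "- q"] by simp

lemma subst_sum [simp]: "subst s (sum f I) = (\<Sum>i\<in>I. subst s (f i))"
  by (induction I rule: infinite_finite_induct) auto

text \<open>Additive identities can be checked on single terms, which avoids tracking the
  cancellations that change the support of a sum.\<close>

lemma poly_single_induct [case_names single add]:
  fixes p :: poly
  assumes "\<And>m c. P (single m c)" "\<And>p q. P p \<Longrightarrow> P q \<Longrightarrow> P (p + q)"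
  shows "P p"
proof -
  have sum_P: "P (\<Sum>m\<in>A. single m (lookup p m))" if "finite A" for A
    using that assms(1)[of 0 0] by induction (auto intro: assms)
  have "p = (\<Sum>m\<in>keys p. single m (lookup p m))"
    by (rule poly_mapping_eqI)
      (auto simp: lookup_sum lookup_single when_def in_keys_iff)
  then show ?thesis using sum_P[OF finite_keys] by metis
qed

lemma subst_mult [simp]: "subst s (p * q) = subst s p * subst s q"
proof (induction p rule: poly_single_induct)
  case (single m c)
  show ?case
    by (induction q rule: poly_single_induct)
      (simp_all add: mult_single subst_single mon_subst_add distrib_left)
qed (simp add: distrib_right)

lemma single_zero_eq_of_int: "single 0 c = (of_int c :: poly)"
  using single_of_int[of c, where ?'b = int] by simp

lemma subst_of_int [simp]: "subst s (of_int c) = of_int c"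
  using subst_single[of s 0 c] by (simp add: single_zero_eq_of_int)

lemma subst_1 [simp]: "subst s 1 = 1"
  using subst_of_int[of s 1] by simp

lemma subst_power [simp]: "subst s (p ^ k) = subst s p ^ k"
  by (induction k) auto

lemma subst_prod [simp]: "subst s (prod f I) = (\<Prod>i\<in>I. subst s (f i))"
  by (induction I rule: infinite_finite_induct) auto

lemma subst_Var [simp]: "subst s (Var v) = s v"
  by (simp add: Var_def subst_single)

lemma mon_subst_Var: "mon_subst Var m = single m 1"
proof -
  have "(\<Prod>v\<in>A. Var v ^ f v) = single (\<Sum>v\<in>A. single v (f v)) 1" if "finite A" for A f
  proof -
    have pw: "Var v ^ k = single (single v k) 1" for v k
      by (induction k) (auto simp: Var_def mult_single single_add[symmetric])
    show ?thesis using that by induction (auto simp: pw mult_single)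
  qed
  moreover have "m = (\<Sum>v\<in>keys m. single v (lookup m v))"
    by (rule poly_mapping_eqI)
      (auto simp: lookup_sum lookup_single when_def in_keys_iff)
  ultimately show ?thesis by (metis finite_keys mon_subst_def)
qed

lemma mon_subst_comp: "subst s (mon_subst r m) = mon_subst (\<lambda>v. subst s (r v)) m"
  by (simp add: mon_subst_def)

text \<open>A substitution is a ring homomorphism, so a composite is determined by its values on
  variables. Each commutation relation between operators below becomes a case check on
  variables.\<close>

lemma subst_subst: "subst s (subst r p) = subst (\<lambda>v. subst s (r v)) p"
  by (simp add: subst_alt[of r] subst_alt[of "\<lambda>v. subst s (r v)"] mon_subst_comp)

lemma subst_cong:
  assumes "\<And>v. v \<in> vars p \<Longrightarrow> s v = r v"
  shows "subst s p = subst r p"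
  unfolding subst_def
  by (intro sum.cong prod.cong refl arg_cong2[where f = "(*)"] arg_cong2[where f = "power"] assms)
    (auto simp: vars_def)

lemma subst_Var_id: "subst Var p = p"
  by (induction p rule: poly_single_induct)
    (simp_all add: subst_single mon_subst_Var mult_single
       flip: single_zero_eq_of_int)

section \<open>Variables occurring in a polynomial\<close>

lemma vars_add: "vars (p + q) \<subseteq> vars p \<union> vars q"
  using Poly_Mapping.keys_add[of p q] by (auto simp: vars_def)

lemma vars_uminus [simp]: "vars (- p) = vars p"
  by (simp add: vars_def)

lemma vars_diff: "vars (p - q) \<subseteq> vars p \<union> vars q"
  using vars_add[of p "- q"] by simp

lemma vars_0 [simp]: "vars 0 = {}"
  by (simp add: vars_def)

lemma vars_of_int [simp]: "vars (of_int c) = {}"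
proof -
  have "keys (of_int c :: poly) \<subseteq> {0}"
    unfolding single_zero_eq_of_int[symmetric] by simp
  then show ?thesis by (auto simp: vars_def)
qed

lemma vars_1 [simp]: "vars 1 = {}"
  using vars_of_int[of 1] by simp

lemma vars_Var [simp]: "vars (Var v) = {v}"
  by (simp add: vars_def Var_def)

lemma vars_mult: "vars (p * q) \<subseteq> vars p \<union> vars q"
proof
  fix v assume "v \<in> vars (p * q)"
  then obtain m where m: "m \<in> keys (p * q)" "v \<in> keys m" by (auto simp: vars_def)
  then obtain a b where "m = a + b" "a \<in> keys p" "b \<in> keys q"
    using Poly_Mapping.keys_mult[of p q] by auto
  then show "v \<in> vars p \<union> vars q"
    using m(2) Poly_Mapping.keys_add[of a b] by (auto simp: vars_def)
qed

lemma vars_sum: "vars (sum f I) \<subseteq> (\<Union>i\<in>I. vars (f i))"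
  by (induction I rule: infinite_finite_induct) (use vars_add in fastforce)+

lemma vars_prod: "vars (prod f I) \<subseteq> (\<Union>i\<in>I. vars (f i))"
  by (induction I rule: infinite_finite_induct) (use vars_mult in fastforce)+

lemma vars_power: "vars (p ^ k) \<subseteq> vars p"
  by (induction k) (use vars_mult in fastforce)+

lemma finite_vars [simp]: "finite (vars p)"
  by (simp add: vars_def)

lemma vars_subst: "vars (subst s p) \<subseteq> (\<Union>v\<in>vars p. vars (s v))"
proof -
  have "vars (of_int (lookup p m) * (\<Prod>v\<in>keys m. s v ^ lookup m v)) \<subseteq> (\<Union>v\<in>vars p. vars (s v))"
    if "m \<in> keys p" for m
  proof -
    have "vars (\<Prod>v\<in>keys m. s v ^ lookup m v) \<subseteq> (\<Union>v\<in>keys m. vars (s v))"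
      using vars_prod[of "\<lambda>v. s v ^ lookup m v" "keys m"] vars_power by fastforce
    moreover have "vars (of_int (lookup p m) * (\<Prod>v\<in>keys m. s v ^ lookup m v)) \<subseteq>
        vars (\<Prod>v\<in>keys m. s v ^ lookup m v)"
      using vars_mult by (metis Un_empty_left vars_of_int)
    moreover have "(\<Union>v\<in>keys m. vars (s v)) \<subseteq> (\<Union>v\<in>vars p. vars (s v))"
      using that by (auto simp: vars_def)
    ultimately show ?thesis by (meson order_trans)
  qed
  then show ?thesis
    unfolding subst_def by (intro order_trans[OF vars_sum UN_least])
qed

section \<open>Grading by total degree and t-degree\<close>

definition weight :: "(var \<Rightarrow> nat) \<Rightarrow> (var \<Rightarrow>\<^sub>0 nat) \<Rightarrow> nat" where
  "weight w m = (\<Sum>v\<in>keys m. lookup m v * w v)"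

lemma weight_0 [simp]: "weight w 0 = 0"
  by (simp add: weight_def)

lemma weight_add [simp]: "weight w (m + m') = weight w m + weight w m'"
proof -
  have sup: "weight w k = (\<Sum>v\<in>keys m \<union> keys m'. lookup k v * w v)"
    if "keys k \<subseteq> keys m \<union> keys m'" for k
    unfolding weight_def
    by (rule sum.mono_neutral_left) (use that in \<open>auto simp: in_keys_iff\<close>)
  show ?thesis
    using Poly_Mapping.keys_add[of m m']
    by (simp add: sup lookup_add distrib_right sum.distrib)
qed

lemma weight_single [simp]: "weight w (single v k) = k * w v"
  by (cases "k = 0") (simp_all add: weight_def)

definition is_T :: "var \<Rightarrow> nat" where
  "is_T v = (case v of X j \<Rightarrow> 0 | T j \<Rightarrow> 1)"

lemma is_T_simps [simp]: "is_T (X j) = 0" "is_T (T j) = 1"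
  by (simp_all add: is_T_def)

text \<open>The total degree is exact, while the t-degree is only bounded below: for fixed
  \<open>d\<close> this is the filtration along which solutions are corrected.\<close>

definition graded :: "nat \<Rightarrow> nat \<Rightarrow> poly set" where
  "graded d k = {p. \<forall>m\<in>keys p. weight (\<lambda>_. 1) m = d \<and> k \<le> weight is_T m}"

lemma graded_0 [simp]: "0 \<in> graded d k"
  by (simp add: graded_def)

lemma graded_add: "p \<in> graded d k \<Longrightarrow> q \<in> graded d k \<Longrightarrow> p + q \<in> graded d k"
  using Poly_Mapping.keys_add[of p q] by (fastforce simp: graded_def)

lemma graded_uminus: "p \<in> graded d k \<Longrightarrow> - p \<in> graded d k"
  by (simp add: graded_def)

lemma graded_diff: "p \<in> graded d k \<Longrightarrow> q \<in> graded d k \<Longrightarrow> p - q \<in> graded d k"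
  using graded_add[of p d k "- q"] graded_uminus by simp

lemma graded_sum: "(\<And>i. i \<in> I \<Longrightarrow> f i \<in> graded d k) \<Longrightarrow> sum f I \<in> graded d k"
  by (induction I rule: infinite_finite_induct) (auto intro: graded_add)

lemma graded_mult: "p \<in> graded d k \<Longrightarrow> q \<in> graded e l \<Longrightarrow> p * q \<in> graded (d + e) (k + l)"
  using Poly_Mapping.keys_mult[of p q] by (force simp: graded_def intro: add_mono)

lemma graded_of_int [simp]: "of_int c \<in> graded 0 0"
proof -
  have "keys (of_int c :: poly) \<subseteq> {0}"
    unfolding single_zero_eq_of_int[symmetric] by simp
  then show ?thesis by (auto simp: graded_def)
qed

lemma graded_1 [simp]: "1 \<in> graded 0 0"
  using graded_of_int[of 1] by simp

lemma graded_Var [simp]: "Var v \<in> graded 1 (is_T v)"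
  by (simp add: graded_def Var_def)

lemma graded_mono: "p \<in> graded d k \<Longrightarrow> l \<le> k \<Longrightarrow> p \<in> graded d l"
  by (fastforce simp: graded_def)

text \<open>The t-degree of a monomial is at most its total degree, so the filtration reaches zero
  after finitely many steps. This ends the successive corrections in
  \<open>antiderivative\<close>.\<close>

lemma graded_empty:
  assumes "p \<in> graded d k" "d < k"
  shows "p = 0"
proof -
  have "weight is_T m \<le> weight (\<lambda>_. 1) m" for m
    unfolding weight_def by (rule sum_mono) (simp add: is_T_def split: var.split)
  then have "m \<notin> keys p" for m
    using assms order_trans[of k "weight is_T m" "weight (\<lambda>_. 1) m"] by (auto simp: graded_def)
  then have "keys p = {}" by blast
  then show ?thesis by simp
qed

lemma graded_homogeneous: "p \<in> graded d k \<Longrightarrow> homogeneous p"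
  by (auto simp: graded_def homogeneous_def weight_def)

lemma monomial_induct [case_names zero step]:
  fixes m :: "var \<Rightarrow>\<^sub>0 nat"
  assumes "P 0" "\<And>m v. P m \<Longrightarrow> P (m + single v 1)"
  shows "P m"
proof (induction "weight (\<lambda>_. 1) m" arbitrary: m)
  case 0
  then have "m = 0"
    by (intro poly_mapping_eqI) (auto simp: weight_def in_keys_iff)
  then show ?case using assms(1) by simp
next
  case (Suc d)
  then obtain v where v: "v \<in> keys m" by (fastforce simp: weight_def)
  have m: "m = (m - single v 1) + single v 1"
    using v by (intro poly_mapping_eqI)
      (auto simp: lookup_add lookup_minus lookup_single when_def in_keys_iff)
  have "weight (\<lambda>_. 1) m = weight (\<lambda>_. 1) (m - single v 1) + 1"
    by (subst m) simp
  then have "P (m - single v 1)" using Suc by simp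
  then have "P ((m - single v 1) + single v 1)" by (rule assms(2))
  then show ?case unfolding m[symmetric] .
qed

text \<open>An x-variable may go to any linear form, a t-variable only to a linear form in the
  t-variables; this is what preserves the filtration.\<close>

definition weighted_subst :: "(var \<Rightarrow> poly) \<Rightarrow> bool" where
  "weighted_subst s = (\<forall>v. s v \<in> graded 1 (is_T v))"

lemma mon_subst_graded:
  assumes "weighted_subst s"
  shows "mon_subst s m \<in> graded (weight (\<lambda>_. 1) m) (weight is_T m)"
proof (induction m rule: monomial_induct)
  case (step m v)
  then show ?case
    using graded_mult[of _ _ _ "s v" 1 "is_T v"] assms
    by (simp add: mon_subst_add weighted_subst_def)
qed simp

lemma subst_graded:
  assumes "weighted_subst s" "p \<in> graded d k"
  shows "subst s p \<in> graded d k"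
  unfolding subst_alt
proof (rule graded_sum)
  fix m assume "m \<in> keys p"
  then have "weight (\<lambda>_. 1) m = d" "k \<le> weight is_T m"
    using assms(2) by (auto simp: graded_def)
  then have "mon_subst s m \<in> graded d k"
    using mon_subst_graded[OF assms(1)] graded_mono by metis
  then show "of_int (lookup p m) * mon_subst s m \<in> graded d k"
    using graded_mult[OF graded_of_int] by fastforce
qed

text \<open>Substitutions that agree on variables to leading order in t agree on monomials to
  leading order: exchange the factors one at a time.\<close>

lemma mon_subst_diff_graded:
  assumes "weighted_subst s" "weighted_subst r" "\<And>v. s v - r v \<in> graded 1 (Suc (is_T v))"
  shows "mon_subst s m - mon_subst r m \<in> graded (weight (\<lambda>_. 1) m) (Suc (weight is_T m))"
proof (induction m rule: monomial_induct)
  case (step m v)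
  have eq: "mon_subst s (m + single v 1) - mon_subst r (m + single v 1) =
      mon_subst s m * (s v - r v) + (mon_subst s m - mon_subst r m) * r v"
    by (simp add: mon_subst_add algebra_simps)
  show ?case unfolding eq
    using graded_mult[OF mon_subst_graded[OF assms(1)] assms(3), of m v]
      graded_mult[OF step, of "r v" 1 "is_T v"] assms(2)
    by (auto intro: graded_add simp: weighted_subst_def)
qed simp

lemma subst_diff_graded:
  assumes "weighted_subst s" "weighted_subst r" "\<And>v. s v - r v \<in> graded 1 (Suc (is_T v))"
    and "p \<in> graded d k"
  shows "subst s p - subst r p \<in> graded d (Suc k)"
proof -
  have eq: "subst s p - subst r p =
      (\<Sum>m\<in>keys p. of_int (lookup p m) * (mon_subst s m - mon_subst r m))"
    by (simp add: subst_alt right_diff_distrib sum_subtractf)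
  show ?thesis unfolding eq
  proof (rule graded_sum)
    fix m assume "m \<in> keys p"
    then have "weight (\<lambda>_. 1) m = d" "k \<le> weight is_T m"
      using assms(4) by (auto simp: graded_def)
    then have "mon_subst s m - mon_subst r m \<in> graded d (Suc k)"
      using mon_subst_diff_graded[OF assms(1-3), of m] graded_mono by fastforce
    then show "of_int (lookup p m) * (mon_subst s m - mon_subst r m) \<in> graded d (Suc k)"
      using graded_mult[OF graded_of_int] by fastforce
  qed
qed

section \<open>Insertion operators and their divided differences\<close>

text \<open>The inserted entry \<open>a\<close> is left general so that the operators
  \<open>Rminus\<close> and \<open>Rplus\<close> (with \<open>a\<close> a t-variable) and their
  specialization at t = 0 (with \<open>a\<close> zero) share one theory.\<close>

definition ins_var :: "nat \<Rightarrow> poly \<Rightarrow> var \<Rightarrow> poly" where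
  "ins_var i a v = (case v of
      X j \<Rightarrow> (if j < i then Var (X j) else if j = i then a else Var (X (j - 1)))
    | T j \<Rightarrow> Var (T j))"

definition ins :: "nat \<Rightarrow> poly \<Rightarrow> poly \<Rightarrow> poly" where
  "ins i a = subst (ins_var i a)"

definition delta :: "nat \<Rightarrow> poly \<Rightarrow> poly \<Rightarrow> poly" where
  "delta i a f = ins (Suc i) a f - ins i a f"

lemma ins_hom [simp]:
  "ins i a 0 = 0" "ins i a (p + q) = ins i a p + ins i a q" "ins i a (p - q) = ins i a p - ins i a q"
  "ins i a (p * q) = ins i a p * ins i a q" "ins i a (sum f I) = (\<Sum>i'\<in>I. ins i a (f i'))"
  by (simp_all add: ins_def)

lemma ins_Var: "ins i a (Var v) = ins_var i a v"
  by (simp add: ins_def)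

lemma Rminus_eq_ins: "Rminus i = ins i (Var (T i))"
  unfolding Rminus_def ins_def
  by (intro arg_cong[where f = subst] ext) (simp add: ins_var_def split: var.split)

lemma Rplus_eq_ins: "Rplus i = ins (Suc i) (Var (T i))"
  unfolding Rplus_def ins_def
  by (intro arg_cong[where f = subst] ext) (auto simp: ins_var_def split: var.split)

lemma Rdiff_eq_delta: "Rplus i f - Rminus i f = delta i (Var (T i)) f"
  by (simp add: Rplus_eq_ins Rminus_eq_ins delta_def)

lemma delta_0 [simp]: "delta i a 0 = 0"
  by (simp add: delta_def)

lemma delta_add: "delta i a (p + q) = delta i a p + delta i a q"
  by (simp add: delta_def)

lemma delta_diff: "delta i a (p - q) = delta i a p - delta i a q"
  by (simp add: delta_def)

lemma delta_sum: "delta i a (sum f I) = (\<Sum>i'\<in>I. delta i a (f i'))"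
  by (simp add: delta_def sum_subtractf)

section \<open>Division by x_i - t_i\<close>

lemma lookup_Var_mult_add: "lookup (Var v * p) (m + single v 1) = lookup p m"
proof (induction p rule: poly_single_induct)
  case (single m' c)
  have "single v 1 + m' = m + single v 1 \<longleftrightarrow> m' = m"
    by (metis add.commute add_left_cancel)
  then show ?case by (simp add: Var_def mult_single lookup_single when_def)
qed (simp add: distrib_left lookup_add)

lemma keys_Var_mult: "m \<in> keys (Var v * p) \<Longrightarrow> \<exists>m'\<in>keys p. m = m' + single v 1"
  using Poly_Mapping.keys_mult[of "Var v" p] by (auto simp: Var_def add.commute)

text \<open>Comparing coefficients of \<open>x\<^sub>i m\<close> in \<open>(x\<^sub>i - t\<^sub>i) g\<close> determines the coefficient of \<open>m\<close>
  in \<open>g\<close> from one of smaller t-degree.\<close>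
lemma quotient_keys:
  assumes h: "(Var (X i) - Var (T i)) * g = h"
    and step: "\<And>m. m + single (X i) 1 \<in> keys h \<Longrightarrow> Q m"
      "\<And>m m'. Q m' \<Longrightarrow> m' + single (T i) 1 = m + single (X i) 1 \<Longrightarrow> Q m"
    and "m \<in> keys g"
  shows "Q m"
  using \<open>m \<in> keys g\<close>
proof (induction "weight is_T m" arbitrary: m rule: less_induct)
  case less
  show ?case
  proof (cases "m + single (X i) 1 \<in> keys h")
    case True
    then show ?thesis by (rule step)
  next
    case False
    then have "lookup (Var (T i) * g) (m + single (X i) 1) = lookup g m"
      using h lookup_Var_mult_add[of "X i" g m]
      by (auto simp: in_keys_iff lookup_minus left_diff_distrib)
    then have "m + single (X i) 1 \<in> keys (Var (T i) * g)"
      using less.prems by (simp add: in_keys_iff)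
    then obtain m' where m': "m' \<in> keys g" "m + single (X i) 1 = m' + single (T i) 1"
      using keys_Var_mult by blast
    then have "weight is_T (m + single (X i) 1) = weight is_T (m' + single (T i) 1)" by simp
    then have "weight is_T m' < weight is_T m" by simp
    then show ?thesis using less.hyps m' step(2) by metis
  qed
qed

text \<open>The factor x_i - t_i is not a zero divisor, which gives the description in
  \<open>Ediv\<close> at most one solution.\<close>

lemma quotient_unique:
  assumes "(Var (X i) - Var (T i)) * g = (Var (X i) - Var (T i)) * g'"
  shows "g = g'"
proof -
  have "(Var (X i) - Var (T i)) * (g - g') = 0"
    using assms by (simp add: algebra_simps)
  then have "m \<notin> keys (g - g')" for m
    \<comment> \<open>With the constantly false predicate, \<open>quotient_keys\<close> says that a
      quotient of zero has no monomials.\<close>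
    using quotient_keys[of i "g - g'" 0 "\<lambda>_. False" m] by auto
  then have "keys (g - g') = {}" by blast
  then show ?thesis by simp
qed

text \<open>Trading an x_i for a t_i keeps the total degree and raises the t-degree, so both
  conditions pass along the recursion of \<open>quotient_keys\<close>.\<close>

lemma quotient_graded:
  assumes "(Var (X i) - Var (T i)) * g \<in> graded (Suc d) k"
  shows "g \<in> graded d k"
proof -
  have "weight (\<lambda>_. 1) m = d \<and> k \<le> weight is_T m" if "m \<in> keys g" for m
  proof (rule quotient_keys[OF refl _ _ that])
    fix m m' assume *: "weight (\<lambda>_. 1) m' = d \<and> k \<le> weight is_T m'"
      "m' + single (T i) 1 = m + single (X i) 1"
    have "weight w (m' + single (T i) 1) = weight w (m + single (X i) 1)" for w
      using * by simp
    from this[of "\<lambda>_. 1"] this[of is_T] * show "weight (\<lambda>_. 1) m = d \<and> k \<le> weight is_T m"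
      by simp
  next
    fix m assume "m + single (X i) 1 \<in> keys ((Var (X i) - Var (T i)) * g)"
    then have "weight (\<lambda>_. 1) (m + single (X i) 1) = Suc d \<and> k \<le> weight is_T (m + single (X i) 1)"
      using assms by (auto simp: graded_def)
    then show "weight (\<lambda>_. 1) m = d \<and> k \<le> weight is_T m" by simp
  qed
  then show ?thesis by (auto simp: graded_def)
qed

lemma keys_add_left: "keys m \<subseteq> keys (m + m')" for m :: "var \<Rightarrow>\<^sub>0 nat"
  by (auto simp: in_keys_iff lookup_add)

lemma quotient_vars:
  assumes "vars ((Var (X i) - Var (T i)) * g) \<subseteq> V" "T i \<in> V"
  shows "vars g \<subseteq> V"
proof -
  have "keys m \<subseteq> V" if "m \<in> keys g" for m
  proof (rule quotient_keys[OF refl _ _ that])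
    fix m m' :: "var \<Rightarrow>\<^sub>0 nat"
    assume *: "keys m' \<subseteq> V" "m' + single (T i) 1 = m + single (X i) 1"
    have "keys (m + single (X i) 1) \<subseteq> insert (T i) (keys m')"
      using *(2) Poly_Mapping.keys_add[of m' "single (T i) 1"] by auto
    then show "keys m \<subseteq> V"
      using keys_add_left[of m "single (X i) 1"] *(1) assms(2) by blast
  next
    fix m assume "m + single (X i) 1 \<in> keys ((Var (X i) - Var (T i)) * g)"
    then have "keys (m + single (X i) 1) \<subseteq> V"
      using assms(1) by (auto simp: vars_def)
    then show "keys m \<subseteq> V"
      using keys_add_left[of m "single (X i) 1"] by blast
  qed
  then show ?thesis by (auto simp: vars_def)
qed

lemma Var_mult_graded_cancel:
  assumes "Var (X i) * g \<in> graded (Suc d) k"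
  shows "g \<in> graded d k"
proof -
  have "weight (\<lambda>_. 1) m = d \<and> k \<le> weight is_T m" if "m \<in> keys g" for m
  proof -
    have "m + single (X i) 1 \<in> keys (Var (X i) * g)"
      using that by (simp add: in_keys_iff lookup_Var_mult_add[of "X i", simplified])
    then have "weight (\<lambda>_. 1) (m + single (X i) 1) = Suc d \<and> k \<le> weight is_T (m + single (X i) 1)"
      using assms by (auto simp: graded_def)
    then show ?thesis by simp
  qed
  then show ?thesis by (auto simp: graded_def)
qed

text \<open>Modulo \<open>c\<close> the two substitutions are the same ring homomorphism.\<close>

lemma dvd_subst_diff:
  assumes "\<And>v. c dvd s v - r v"
  shows "c dvd subst s p - subst r p"
proof -
  have mon: "c dvd mon_subst s m - mon_subst r m" for m
  proof (induction m rule: monomial_induct)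
    case (step m v)
    have "mon_subst s (m + single v 1) - mon_subst r (m + single v 1) =
        mon_subst s m * (s v - r v) + (mon_subst s m - mon_subst r m) * r v"
      by (simp add: mon_subst_add algebra_simps)
    then show ?case using step assms by simp
  qed simp
  have "subst s p - subst r p = (\<Sum>m\<in>keys p. of_int (lookup p m) * (mon_subst s m - mon_subst r m))"
    by (simp add: subst_alt right_diff_distrib sum_subtractf)
  then show ?thesis using mon by (simp add: dvd_sum)
qed

text \<open>The two insertions differ only on x_i and x_(i+1), by x_i - a and its negative.\<close>

lemma dvd_delta: "Var (X i) - a dvd delta i a f"
  unfolding delta_def ins_def
proof (rule dvd_subst_diff)
  fix v show "Var (X i) - a dvd ins_var (Suc i) a v - ins_var i a v"
    using dvd_minus_iff[of "Var (X i) - a" "Var (X i) - a"]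
    by (auto simp: ins_var_def split: var.split)
qed

lemma Ediv_eqI:
  assumes "delta i (Var (T i)) f = (Var (X i) - Var (T i)) * g"
  shows "Ediv i f = g"
  unfolding Ediv_def Rdiff_eq_delta
  by (rule the_equality) (use assms quotient_unique in auto)

lemma delta_eq_Ediv: "delta i (Var (T i)) f = (Var (X i) - Var (T i)) * Ediv i f"
  using dvd_delta[of i "Var (T i)" f] Ediv_eqI[of i f] by (auto elim!: dvdE)

section \<open>Noncrossing evaluations\<close>

lemma ev_cong:
  assumes "f \<in> poly_xn n" "\<And>j. 1 \<le> j \<Longrightarrow> j \<le> n \<Longrightarrow> \<sigma> j = \<tau> j"
  shows "ev \<sigma> f = ev \<tau> f"
  unfolding ev_def
  by (rule subst_cong) (use assms in \<open>auto simp: poly_xn_def split: var.split\<close>)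

lemma ev_adjacent_swap:
  assumes "f \<in> EQSym n" "1 \<le> i" "i < n" "\<tau> i = i"
  shows "ev \<tau> f = ev (\<tau>(i := \<tau> (Suc i), Suc i := i)) f"
proof -
  \<comment> \<open>\<open>\<rho>\<close> evaluates at the sequence \<open>\<tau>\<close> with entry
    i deleted. Inserting t_i at position i restores \<open>\<tau>\<close>; inserting it at position
    i + 1 gives the swapped sequence.\<close>
  define \<rho> where "\<rho> v = (case v of X j \<Rightarrow> Var (T (\<tau> (if j < i then j else Suc j))) | T j \<Rightarrow> Var (T j))" for v
  have "subst \<rho> (ins i (Var (T i)) f) = ev \<tau> f"
    unfolding ins_def ev_def subst_subst
    by (intro arg_cong2[where f = subst] ext refl)
      (use assms in \<open>auto simp: ins_var_def \<rho>_def split: var.split\<close>)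
  moreover have "subst \<rho> (ins (Suc i) (Var (T i)) f) = ev (\<tau>(i := \<tau> (Suc i), Suc i := i)) f"
    unfolding ins_def ev_def subst_subst
    by (intro arg_cong2[where f = subst] ext refl)
      (use assms in \<open>auto simp: ins_var_def \<rho>_def split: var.split\<close>)
  moreover have "ins (Suc i) (Var (T i)) f = ins i (Var (T i)) f"
    using assms by (auto simp: EQSym_def simp flip: Rplus_eq_ins Rminus_eq_ins)
  ultimately show ?thesis by simp
qed

text \<open>A value \<open>a\<close> at position \<open>b > a\<close> can be brought home when all positions in between are fixed:
  move it to position \<open>b - 1\<close>, bring it home from there, and move the value \<open>b - 1\<close> back.\<close>
lemma ev_detach:
  assumes "f \<in> EQSym n" "1 \<le> a" "a < b" "b \<le> n" "\<tau> b = a" "\<And>j. a < j \<Longrightarrow> j < b \<Longrightarrow> \<tau> j = j"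
  shows "ev \<tau> f = ev (\<tau>(a := a, b := \<tau> a)) f"
  using assms(3-)
proof (induction b arbitrary: \<tau>)
  case (Suc c)
  show ?case
  proof (cases "c = a")
    case True
    \<comment> \<open>The swap is applied to the target sequence, which fixes \<open>a\<close>, and
      read backwards.\<close>
    let ?\<tau> = "\<tau>(a := a, Suc c := \<tau> a)"
    have "ev ?\<tau> f = ev (?\<tau>(a := ?\<tau> (Suc a), Suc a := a)) f"
      by (rule ev_adjacent_swap[OF assms(1,2)]) (use Suc.prems True in auto)
    also have "?\<tau>(a := ?\<tau> (Suc a), Suc a := a) = \<tau>"
      using Suc.prems True by auto
    finally show ?thesis ..
  next
    case False
    then have ac: "a < c" using Suc.prems by simp
    then have c: "\<tau> c = c" using Suc.prems by simp
    let ?\<tau>1 = "\<tau>(c := a, Suc c := c)"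
    let ?\<tau>2 = "?\<tau>1(a := a, c := \<tau> a)"
    let ?\<tau>3 = "\<tau>(a := a, Suc c := \<tau> a)"
    have "ev \<tau> f = ev (\<tau>(c := \<tau> (Suc c), Suc c := c)) f"
      by (rule ev_adjacent_swap[OF assms(1)]) (use Suc.prems ac c in auto)
    also have "\<dots> = ev ?\<tau>1 f" using Suc.prems by simp
    also have "\<dots> = ev (?\<tau>1(a := a, c := ?\<tau>1 a)) f"
      by (rule Suc.IH) (use Suc.prems ac in auto)
    also have "\<dots> = ev ?\<tau>2 f" using ac by simp
    also have "\<dots> = ev (?\<tau>3(c := ?\<tau>3 (Suc c), Suc c := c)) f"
      by (rule arg_cong[where f = "\<lambda>\<tau>. ev \<tau> f"]) (use ac c in auto)
    also have "\<dots> = ev ?\<tau>3 f"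
      by (rule ev_adjacent_swap[OF assms(1), symmetric]) (use Suc.prems ac c in auto)
    finally show ?thesis .
  qed
qed simp

text \<open>Its cardinality measures the distance from the partition into singletons and decreases
  whenever an element is split off a larger block.\<close>

definition block_pairs :: "nat set set \<Rightarrow> (nat \<times> nat) set" where
  "block_pairs P = {(a, b). a < b \<and> (\<exists>B\<in>P. a \<in> B \<and> b \<in> B)}"

lemma perm_of_partition_block:
  assumes "partition_on A P" "B \<in> P" "a \<in> B"
  shows "perm_of_partition P a = (if \<exists>b\<in>B. b < a then Max {b\<in>B. b < a} else Max B)"
proof -
  have "(THE B. B \<in> P \<and> a \<in> B) = B"
    using assms partition_onD2[OF assms(1)] by (intro the_equality) (auto dest: disjointD)
  then show ?thesis using assms by (auto simp: perm_of_partition_def Let_def)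
qed

lemma perm_of_partition_singleton:
  assumes "partition_on A P" "{a} \<in> P"
  shows "perm_of_partition P a = a"
  using perm_of_partition_block[OF assms, of a] by simp

text \<open>Detaching \<open>a\<close> from its block turns the permutation of \<open>P\<close> into
  that of a noncrossing partition with fewer block pairs, and \<open>ev_detach\<close> shows that
  the evaluation does not change.\<close>

lemma ev_noncrossing:
  assumes f: "f \<in> EQSym n"
  shows "partition_on {1..n} P \<Longrightarrow> noncrossing P \<Longrightarrow> ev (perm_of_partition P) f = ev id f"
proof (induction "card (block_pairs P)" arbitrary: P rule: less_induct)
  case less
  note part = less.prems(1)
  have fx: "f \<in> poly_xn n" using f by (simp add: EQSym_def)
  have eqB: "B = C" if "B \<in> P" "C \<in> P" "x \<in> B" "x \<in> C" for B C x
    using that partition_onD2[OF part] by (auto dest: disjointD)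
  have sub: "B \<subseteq> {1..n}" if "B \<in> P" for B
    using that partition_onD1[OF part] by auto
  have ex_block: "\<exists>B\<in>P. j \<in> B" if "1 \<le> j" "j \<le> n" for j
    using that partition_onD1[OF part] by (metis UnionE atLeastAtMost_iff)
  have fin: "finite (block_pairs P)"
    by (rule finite_subset[of _ "{1..n} \<times> {1..n}"]) (use sub in \<open>auto simp: block_pairs_def\<close>)
  show ?case
  proof (cases "block_pairs P = {}")
    case True
    have "perm_of_partition P j = id j" if j: "1 \<le> j" "j \<le> n" for j
    proof -
      obtain B where B: "B \<in> P" "j \<in> B" using ex_block[OF j] by blast
      have "B = {j}"
        using True B by (auto simp: block_pairs_def) (metis linorder_neqE_nat)
      then show ?thesis using perm_of_partition_singleton[OF part] B by simp
    qed
    then show ?thesis by (rule ev_cong[OF fx])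
  next
    case False
    then obtain q0 where "q0 \<in> block_pairs P" by blast
    from ex_has_least_nat[of "\<lambda>q. q \<in> block_pairs P", OF this, of "\<lambda>q. snd q - fst q"]
    obtain q where q: "q \<in> block_pairs P"
        "\<And>q'. q' \<in> block_pairs P \<Longrightarrow> snd q - fst q \<le> snd q' - fst q'"
      by blast
    obtain a b where qab: "q = (a, b)" by fastforce
    obtain B where B: "B \<in> P" "a \<in> B" "b \<in> B" and ab: "a < b"
      using q(1) by (auto simp: qab block_pairs_def)
    have gap: "b - a \<le> d - c" if "C \<in> P" "c \<in> C" "d \<in> C" "c < d" for C c d
      using q(2)[of "(c, d)"] that by (auto simp: qab block_pairs_def)
    have no_between: "j \<notin> B" if "a < j" "j < b" for j
      using gap[OF B(1,2), of j] that by auto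
    have finB: "finite B" using sub[OF B(1)] finite_subset by blast
    \<comment> \<open>A second element of the block of j would cross B if it lay outside the
      interval from a to b, and would form a pair closer than (a, b) if it lay inside.\<close>
    have single_between: "{j} \<in> P" if j: "a < j" "j < b" for j
    proof -
      have "1 \<le> j" "j \<le> n" using j sub[OF B(1)] B by auto
      then obtain C where C: "C \<in> P" "j \<in> C" using ex_block by blast
      then have neq: "B \<noteq> C" using no_between j by blast
      have "c = j" if c: "c \<in> C" for c
      proof (rule ccontr)
        assume "c \<noteq> j"
        have "c \<noteq> a" "c \<noteq> b" using eqB[OF B(1) C(1)] B c neq by auto
        moreover have "\<not> c < a"
          using less.prems(2) neq C B j c unfolding noncrossing_def by metis
        moreover have "\<not> b < c"
          using less.prems(2) neq C B j c unfolding noncrossing_def by metis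
        ultimately have "a < c" "c < b" by auto
        then show False
          using gap[OF C(1) c C(2)] gap[OF C(1) C(2) c] j \<open>c \<noteq> j\<close> by linarith
      qed
      then have "C = {j}" using C by blast
      then show ?thesis using C by simp
    qed
    define P' where "P' = insert {a} (insert (B - {a}) (P - {B}))"
    have part': "partition_on {1..n} P'"
    proof (rule partition_onI)
      show "\<Union> P' = {1..n}"
        using partition_onD1[OF part] B by (auto simp: P'_def)
      show "{} \<notin> P'"
        using partition_onD3[OF part] B ab by (auto simp: P'_def)
      show "disjnt C D" if "C \<in> P'" "D \<in> P'" "C \<noteq> D" for C D
        using that B eqB by (auto simp: P'_def disjnt_def)
    qed
    \<comment> \<open>The singleton cannot take part in a crossing, and all other blocks are
      contained in distinct blocks of P.\<close>
    have nc': "noncrossing P'"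
    proof -
      have nc: False if "C \<in> P" "D \<in> P" "C \<noteq> D" "w \<in> C" "x \<in> C" "y \<in> D" "z \<in> D"
          "w < y" "y < x" "x < z" for C D w x y z
        using less.prems(2)[unfolded noncrossing_def, rule_format, OF that(1-3)] that(4-) by blast
      show ?thesis
        unfolding noncrossing_def
      proof (intro ballI impI notI, elim exE conjE)
        fix C D w x y z
        assume CD: "C \<in> P'" "D \<in> P'" "C \<noteq> D"
          and el: "w \<in> C" "x \<in> C" "y \<in> D" "z \<in> D" "w < y" "y < x" "x < z"
        have "C \<noteq> {a}" "D \<noteq> {a}" using el by auto
        then have "C = B - {a} \<or> C \<in> P - {B}" "D = B - {a} \<or> D \<in> P - {B}"
          using CD by (auto simp: P'_def)
        then show False
          using CD(3) B(1) el nc[of B D w x y z] nc[of C B w x y z] nc[of C D w x y z] by blast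
      qed
    qed
    have sub_pairs: "block_pairs P' \<subset> block_pairs P"
    proof -
      have "block_pairs P' \<subseteq> block_pairs P"
        using B by (auto simp: block_pairs_def P'_def)
      moreover have "(a, b) \<notin> block_pairs P'"
        using B ab eqB by (auto simp: block_pairs_def P'_def)
      ultimately show ?thesis using q(1) qab by blast
    qed
    \<comment> \<open>Since nothing of B lies between them, a is the predecessor of b in B, so b is
      sent to a.\<close>
    have maxb: "Max {c \<in> B. c < b} = a"
      by (rule Max_eqI) (use B ab finB no_between in \<open>auto simp: not_less[symmetric]\<close>)
    \<comment> \<open>The larger element b stays in the block, so removing a cannot lower the
      maximum.\<close>
    have Max_B: "Max (B - {a}) = Max B"
    proof (rule Max_eqI[symmetric])
      show "Max (B - {a}) \<in> B" using finB B ab Max_in[of "B - {a}"] by auto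
      have "b \<le> Max (B - {a})" using finB B ab by (intro Max_ge) auto
      then show "y \<le> Max (B - {a})" if "y \<in> B" for y
        using that finB ab by (cases "y = a") auto
    qed (use finB in auto)
    let ?\<sigma> = "perm_of_partition P"
    have \<sigma>b: "?\<sigma> b = a"
      using perm_of_partition_block[OF part B(1,3)] maxb B ab by auto
    have "ev ?\<sigma> f = ev (?\<sigma>(a := a, b := ?\<sigma> a)) f"
      by (rule ev_detach[OF f])
        (use B ab sub[OF B(1)] \<sigma>b single_between perm_of_partition_singleton[OF part] in auto)
    also have "\<dots> = ev (perm_of_partition P') f"
    proof (rule ev_cong[OF fx])
      fix j assume j: "1 \<le> j" "j \<le> n"
      obtain C where C: "C \<in> P" "j \<in> C" using ex_block[OF j] by blast
      have BP': "B - {a} \<in> P'" by (simp add: P'_def)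
      show "(?\<sigma>(a := a, b := ?\<sigma> a)) j = perm_of_partition P' j"
      proof (cases "C = B")
        case False
        then have "C \<in> P'" "j \<noteq> a" "j \<noteq> b" using C B eqB by (auto simp: P'_def)
        then show ?thesis
          using perm_of_partition_block[OF part C] perm_of_partition_block[OF part' _ C(2)] by simp
      next
        case CB: True
        consider "j = a" | "j = b" | "j \<noteq> a" "j \<noteq> b" by blast
        then show ?thesis
        proof cases
          case 1
          then show ?thesis
            using perm_of_partition_singleton[OF part', of a] ab by (simp add: P'_def)
        next
          case 2
          \<comment> \<open>Without a, the element b inherits the image of a: the predecessor of a
            in B, or the maximum of B if a was the least element.\<close>
          have lt: "{c \<in> B - {a}. c < b} = {c \<in> B. c < a}"
            using ab no_between by (auto simp: not_less) (metis linorder_neqE_nat)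
          show ?thesis
            using perm_of_partition_block[OF part B(1,2)] perm_of_partition_block[OF part' BP', of b]
              lt 2 B ab Max_B by auto
        next
          case 3
          have jB: "j \<in> B" using C CB by simp
          show ?thesis
          proof (cases "j < a")
            case True
            have lt: "{c \<in> B - {a}. c < j} = {c \<in> B. c < j}" using True by auto
            show ?thesis
              using perm_of_partition_block[OF part B(1) jB]
                perm_of_partition_block[OF part' BP', of j] lt 3 jB Max_B by auto
          next
            case False
            then have bj: "b < j" using 3 no_between jB by (meson linorder_neqE_nat)
            \<comment> \<open>For j above b the predecessor is at least b, so the loss of a is not
              noticed.\<close>
            have "Max {c \<in> B - {a}. c < j} = Max {c \<in> B. c < j}"
            proof (rule Max_eqI[symmetric])
              let ?M = "Max {c \<in> B - {a}. c < j}"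
              have "?M \<in> {c \<in> B - {a}. c < j}" using finB B ab bj by (intro Max_in) auto
              then show "?M \<in> {c \<in> B. c < j}" by simp
              have "b \<le> ?M" using finB B ab bj by (intro Max_ge) auto
              then show "y \<le> ?M" if "y \<in> {c \<in> B. c < j}" for y
                using that finB ab by (cases "y = a") auto
            qed (use finB in auto)
            then show ?thesis
              using perm_of_partition_block[OF part B(1) jB]
                perm_of_partition_block[OF part' BP', of j] bj ab B 3 jB by auto
          qed
        qed
      qed
    qed
    also have "\<dots> = ev id f"
      by (rule less.hyps[OF psubset_card_mono[OF fin sub_pairs] part' nc'])
    finally show ?thesis .
  qed
qed

section \<open>A Poincare lemma for the operators \<open>E\<^sub>i\<close>\<close>

lemma poly_xn_0 [simp]: "0 \<in> poly_xn n"
  by (simp add: poly_xn_def)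

lemma poly_xn_add: "p \<in> poly_xn n \<Longrightarrow> q \<in> poly_xn n \<Longrightarrow> p + q \<in> poly_xn n"
  using vars_add[of p q] by (force simp: poly_xn_def)

lemma poly_xn_diff: "p \<in> poly_xn n \<Longrightarrow> q \<in> poly_xn n \<Longrightarrow> p - q \<in> poly_xn n"
  using vars_diff[of p q] by (force simp: poly_xn_def)

lemma poly_xn_mult: "p \<in> poly_xn n \<Longrightarrow> q \<in> poly_xn n \<Longrightarrow> p * q \<in> poly_xn n"
  using vars_mult[of p q] by (force simp: poly_xn_def)

lemma poly_xn_sum: "(\<And>i. i \<in> I \<Longrightarrow> f i \<in> poly_xn n) \<Longrightarrow> sum f I \<in> poly_xn n"
  by (induction I rule: infinite_finite_induct) (auto intro: poly_xn_add)

lemma poly_xn_Var_X: "1 \<le> i \<Longrightarrow> i \<le> n \<Longrightarrow> Var (X i) \<in> poly_xn n"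
  by (simp add: poly_xn_def)

lemma poly_xn_Var_T: "1 \<le> i \<Longrightarrow> Var (T i) \<in> poly_xn n"
  by (simp add: poly_xn_def)

lemma poly_xn_mono: "p \<in> poly_xn n \<Longrightarrow> n \<le> n' \<Longrightarrow> p \<in> poly_xn n'"
  by (force simp: poly_xn_def)

lemma poly_xn_poly_x: "p \<in> poly_xn n \<Longrightarrow> p \<in> poly_x"
  by (force simp: poly_xn_def poly_x_def)

lemma poly_x_poly_xn:
  assumes "p \<in> poly_x"
  obtains n where "p \<in> poly_xn n"
proof
  let ?I = "{i. X i \<in> vars p}"
  have "finite ?I"
    using finite_vimageI[of "vars p" X] by (simp add: inj_def vimage_def)
  then have "i \<le> Max ?I" if "X i \<in> vars p" for i using that by simp
  then show "p \<in> poly_xn (Max ?I)"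
    using assms unfolding poly_x_def poly_xn_def by blast
qed

lemma poly_xn_subst:
  assumes "p \<in> poly_xn n" "\<And>i. 1 \<le> i \<Longrightarrow> i \<le> n \<Longrightarrow> s (X i) \<in> poly_xn m"
    "\<And>i. 1 \<le> i \<Longrightarrow> s (T i) \<in> poly_xn m"
  shows "subst s p \<in> poly_xn m"
proof -
  have "s v \<in> poly_xn m" if "v \<in> vars p" for v
    using that assms unfolding poly_xn_def[of n] by blast
  then have "(\<Union>v\<in>vars p. vars (s v)) \<subseteq> {X i |i. 1 \<le> i \<and> i \<le> m} \<union> {T j |j. 1 \<le> j}"
    unfolding poly_xn_def mem_Collect_eq by (rule UN_least)
  then show ?thesis
    unfolding poly_xn_def mem_Collect_eq by (rule order_trans[OF vars_subst])
qed

lemma poly_xn_ins: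
  assumes "1 \<le> i" "p \<in> poly_xn n" "a \<in> poly_xn n"
  shows "ins i a p \<in> poly_xn n"
  unfolding ins_def
  by (rule poly_xn_subst[OF assms(2)])
    (use assms in \<open>auto simp: ins_var_def intro!: poly_xn_Var_X poly_xn_Var_T\<close>)

lemma ins_beyond:
  assumes "p \<in> poly_xn n" "n < i"
  shows "ins i a p = p"
proof -
  have "ins i a p = subst Var p"
    unfolding ins_def
    by (rule subst_cong) (use assms in \<open>auto simp: poly_xn_def ins_var_def split: var.split\<close>)
  then show ?thesis by (simp add: subst_Var_id)
qed

lemma delta_beyond: "p \<in> poly_xn n \<Longrightarrow> n < i \<Longrightarrow> delta i a p = 0"
  by (simp add: delta_def ins_beyond)

lemma weighted_ins_var: "a \<in> graded 1 0 \<Longrightarrow> weighted_subst (ins_var i a)"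
  using graded_Var[of "X _"] graded_Var[of "T _"]
  by (auto simp: weighted_subst_def ins_var_def split: var.split)

lemma Var_T_graded: "Var (T i) \<in> graded 1 0"
  using graded_mono[OF graded_Var[of "T i"]] by simp

lemma ins_graded: "a \<in> graded 1 0 \<Longrightarrow> p \<in> graded d k \<Longrightarrow> ins i a p \<in> graded d k"
  unfolding ins_def by (intro subst_graded weighted_ins_var)

lemma delta_graded: "a \<in> graded 1 0 \<Longrightarrow> p \<in> graded d k \<Longrightarrow> delta i a p \<in> graded d k"
  unfolding delta_def by (intro graded_diff ins_graded)

text \<open>To leading order in t, inserting t_l is inserting 0. This justifies using the t = 0
  formula as an approximate solution.\<close>

lemma ins_T_diff_graded:
  assumes "p \<in> graded d k"
  shows "ins i (Var (T l)) p - ins i 0 p \<in> graded d (Suc k)"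
  unfolding ins_def
  by (rule subst_diff_graded[OF _ _ _ assms])
    (use graded_Var[of "T l"] in \<open>auto intro!: weighted_ins_var Var_T_graded simp: ins_var_def split: var.split\<close>)

lemma delta_T_diff_graded:
  assumes "p \<in> graded d k"
  shows "delta i (Var (T l)) p - delta i 0 p \<in> graded d (Suc k)"
proof -
  have "delta i (Var (T l)) p - delta i 0 p =
      (ins (Suc i) (Var (T l)) p - ins (Suc i) 0 p) - (ins i (Var (T l)) p - ins i 0 p)"
    by (simp add: delta_def)
  then show ?thesis using ins_T_diff_graded[OF assms] graded_diff by metis
qed

text \<open>Both sides fill slots i and j + 1 of f with a and b: once slot i is filled, slot j + 1
  holds the variable x_j. The last two assumptions keep each inserted entry untouched by the other
  insertion.\<close>

lemma ins_ins:
  assumes "i \<le> j" "ins j b a = a" "ins i a b = b"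
  shows "ins j b (ins i a f) = ins i a (ins (Suc j) b f)"
proof -
  have "subst (ins_var j b) (ins_var i a v) = subst (ins_var i a) (ins_var (Suc j) b v)" for v
    using assms by (auto simp: ins_def ins_var_def split: var.split)
  then show ?thesis by (simp add: ins_def subst_subst)
qed

lemma ins_T [simp]: "ins i a (Var (T j)) = Var (T j)"
  by (simp add: ins_Var ins_var_def)

text \<open>Expanding the differences gives four double insertions, each matched by an instance of
  \<open>ins_ins\<close>.\<close>

lemma delta_delta:
  assumes "i < j"
  shows "delta j (Var (T m)) (delta i (Var (T l)) f) = delta i (Var (T l)) (delta (Suc j) (Var (T m)) f)"
  using assms ins_ins[of i j "Var (T m)" "Var (T l)" f] ins_ins[of "Suc i" j "Var (T m)" "Var (T l)" f]
    ins_ins[of i "Suc j" "Var (T m)" "Var (T l)" f] ins_ins[of "Suc i" "Suc j" "Var (T m)" "Var (T l)" f]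
  by (simp add: delta_def)

lemma delta_mult_left:
  assumes "ins i a c = c'" "ins (Suc i) a c = c'"
  shows "delta i a (c * f) = c' * delta i a f"
  using assms by (simp add: delta_def right_diff_distrib)

text \<open>The relation \<open>E\<^sub>j E\<^sub>i = E\<^sub>i E\<^sub>j\<^sub>+\<^sub>1\<close> for \<open>i < j\<close> (the left \<open>E\<^sub>j\<close> being taken with respect to
  \<open>t\<^sub>j\<^sub>+\<^sub>1\<close>), with both denominators cleared.\<close>
definition compatible :: "(nat \<Rightarrow> poly) \<Rightarrow> bool" where
  "compatible g = (\<forall>i j. 1 \<le> i \<longrightarrow> i < j \<longrightarrow>
     (Var (X i) - Var (T i)) * delta j (Var (T (Suc j))) (g i) =
     (Var (X j) - Var (T (Suc j))) * delta i (Var (T i)) (g (Suc j)))"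

text \<open>Compatibility is thus necessary for an antiderivative. It also ensures that the
  remainder stays compatible after subtracting an approximate solution.\<close>

lemma compatible_Ediv: "compatible (\<lambda>i. Ediv i f)"
  unfolding compatible_def
proof (intro allI impI)
  fix i j :: nat assume ij: "1 \<le> i" "i < j"
  have "(Var (X i) - Var (T i)) * delta j (Var (T (Suc j))) (Ediv i f)
      = delta j (Var (T (Suc j))) ((Var (X i) - Var (T i)) * Ediv i f)"
    by (rule delta_mult_left[symmetric]) (use ij in \<open>auto simp: ins_Var ins_var_def\<close>)
  also have "\<dots> = delta i (Var (T i)) ((Var (X (Suc j)) - Var (T (Suc j))) * Ediv (Suc j) f)"
    by (simp add: delta_eq_Ediv[symmetric] delta_delta[OF ij(2)])
  also have "\<dots> = (Var (X j) - Var (T (Suc j))) * delta i (Var (T i)) (Ediv (Suc j) f)"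
    by (rule delta_mult_left) (use ij in \<open>auto simp: ins_Var ins_var_def\<close>)
  finally show "(Var (X i) - Var (T i)) * delta j (Var (T (Suc j))) (Ediv i f) =
      (Var (X j) - Var (T (Suc j))) * delta i (Var (T i)) (Ediv (Suc j) f)" .
qed

lemma compatible_diff: "compatible g \<Longrightarrow> compatible h \<Longrightarrow> compatible (\<lambda>i. g i - h i)"
  by (simp add: compatible_def delta_diff right_diff_distrib)

lemma Ediv_0 [simp]: "Ediv i 0 = 0"
  by (rule Ediv_eqI) simp

lemma Ediv_add: "Ediv i (f + g) = Ediv i f + Ediv i g"
  by (rule Ediv_eqI) (simp add: delta_add delta_eq_Ediv distrib_left)

lemma Ediv_diff: "Ediv i (f - g) = Ediv i f - Ediv i g"
  by (rule Ediv_eqI) (simp add: delta_diff delta_eq_Ediv right_diff_distrib)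

lemma Ediv_beyond: "f \<in> poly_xn n \<Longrightarrow> n < i \<Longrightarrow> Ediv i f = 0"
  by (rule Ediv_eqI) (simp add: delta_beyond)

lemma Ediv_graded: "f \<in> graded (Suc d) k \<Longrightarrow> Ediv i f \<in> graded d k"
  by (rule quotient_graded[of i], unfold delta_eq_Ediv[symmetric])
    (intro delta_graded Var_T_graded)

lemma Ediv_poly_xn:
  assumes "1 \<le> i" "f \<in> poly_xn n"
  shows "Ediv i f \<in> poly_xn n"
proof -
  have "delta i (Var (T i)) f \<in> poly_xn n"
    unfolding delta_def using assms by (intro poly_xn_diff poly_xn_ins poly_xn_Var_T) auto
  then show ?thesis
    using quotient_vars[of i "Ediv i f"] assms(1) by (simp add: poly_xn_def delta_eq_Ediv)
qed

lemma sum_delta_0: "m \<le> n \<Longrightarrow> (\<Sum>i = m..<n. delta i 0 p) = ins n 0 p - ins m 0 p"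
  unfolding delta_def by (rule sum_Suc_diff')

text \<open>For \<open>t = 0\<close> one has \<open>f - R f = \<Sum>\<^sub>i x\<^sub>i E\<^sub>i f\<close> by telescoping, where \<open>R f = f(0, x\<^sub>1, x\<^sub>2, \<dots>)\<close>. Hence
  \<open>f = \<Sum>\<^sub>l R\<^sup>l (\<Sum>\<^sub>i x\<^sub>i g\<^sub>i)\<close> is forced, and it is a solution up to higher order in \<open>t\<close>.\<close>
lemma approximate_antiderivative:
  assumes gd: "\<And>i. g i \<in> graded d k" and gx: "\<And>i. g i \<in> poly_xn N"
    and g0: "\<And>i. N < i \<Longrightarrow> g i = 0" and comp: "compatible g"
  shows "\<exists>f. f \<in> graded (Suc d) k \<and> f \<in> poly_xn N \<and>
           (\<forall>i\<ge>1. Ediv i f - g i \<in> graded d (Suc k))"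
proof -
  define R where "R = ins 1 0"
  define p where "p = (\<Sum>i = 1..N. Var (X i) * g i)"
  define f where "f = (\<Sum>l<N. (R ^^ l) p)"
  let ?M = "graded (Suc d) (Suc k)"
  have R_hom: "R (q + r) = R q + R r" "R (q - r) = R q - R r" "R (q * r) = R q * R r"
      "R (sum h I) = (\<Sum>i\<in>I. R (h i))" for q r h and I :: "nat set"
    by (simp_all add: R_def)
  have R_X: "R (Var (X (Suc j))) = (if j = 0 then 0 else Var (X j))" for j
    by (simp add: R_def ins_Var ins_var_def)
  have R_graded: "R q \<in> graded e l" if "q \<in> graded e l" for q e l
    unfolding R_def by (rule ins_graded) (use that in auto)
  have R_xn: "R q \<in> poly_xn N" if "q \<in> poly_xn N" for q
    unfolding R_def by (rule poly_xn_ins) (use that in auto)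
  have X_graded: "Var (X i) * q \<in> graded (Suc e) l" if "q \<in> graded e l" for i q e l
    using graded_mult[OF graded_Var[of "X i"] that] by simp
  have p_graded: "p \<in> graded (Suc d) k"
    unfolding p_def by (intro graded_sum X_graded gd)
  have p_xn: "p \<in> poly_xn N"
    unfolding p_def by (intro poly_xn_sum poly_xn_mult gx poly_xn_Var_X) auto
  have "(R ^^ l) p \<in> graded (Suc d) k" for l
    by (induction l) (auto intro: p_graded R_graded)
  then have f_graded: "f \<in> graded (Suc d) k"
    unfolding f_def by (intro graded_sum)
  have "(R ^^ l) p \<in> poly_xn N" for l
    by (induction l) (auto intro: p_xn R_xn)
  then have f_xn: "f \<in> poly_xn N"
    unfolding f_def by (intro poly_xn_sum)
  have R_pow_X: "(R ^^ l) (Var (X i) * q) = (if l < i then Var (X (i - l)) * (R ^^ l) q else 0)"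
    if "1 \<le> i" for l i q
  proof (induction l)
    case (Suc l)
    show ?case
    proof (cases "l < i")
      case True
      then have "Var (X (i - l)) = Var (X (Suc (i - Suc l)))" by (simp add: Suc_diff_Suc)
      then show ?thesis using Suc True R_X[of "i - Suc l"] by (simp add: R_hom)
    qed (use Suc in \<open>simp add: R_def\<close>)
  qed (use that in simp)
  have R_pow_sum: "(R ^^ l) (sum h I) = (\<Sum>i\<in>I. (R ^^ l) (h i))" for l h and I :: "nat set"
    by (induction l) (simp_all add: R_hom)
  \<comment> \<open>Each R lowers the index of x_i and finally kills x_1, so x_i g_i vanishes after
    i \<le> N applications.\<close>
  have "(R ^^ N) p = 0"
    unfolding p_def R_pow_sum by (intro sum.neutral) (simp add: R_pow_X)
  moreover have "R f = (\<Sum>l<N. (R ^^ Suc l) p)"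
    by (simp add: f_def R_hom)
  moreover have "(\<Sum>l<N. (R ^^ l) p - (R ^^ Suc l) p) = (R ^^ 0) p - (R ^^ N) p"
    by (rule sum_lessThan_telescope')
  ultimately have f_R: "f - R f = p"
    by (simp add: f_def sum_subtractf)
  \<comment> \<open>Compatibility with all t-variables set to 0: every error term contains an
    explicit factor t or compares an insertion of a t-variable with an insertion of 0.\<close>
  have swap: "Var (X i) * delta j 0 (g i) - Var (X j) * delta i 0 (g (Suc j)) \<in> ?M"
    if ij: "1 \<le> i" "i < j" for i j
  proof -
    have eq: "Var (X i) * delta j 0 (g i) - Var (X j) * delta i 0 (g (Suc j)) =
        Var (T i) * delta j (Var (T (Suc j))) (g i)
        - Var (T (Suc j)) * delta i (Var (T i)) (g (Suc j))
        - Var (X i) * (delta j (Var (T (Suc j))) (g i) - delta j 0 (g i))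
        + Var (X j) * (delta i (Var (T i)) (g (Suc j)) - delta i 0 (g (Suc j)))"
      using comp ij unfolding compatible_def by (simp add: algebra_simps)
    have "Var (T l) * delta m (Var (T l')) (g r) \<in> ?M" for l m l' r
      using graded_mult[OF graded_Var[of "T l"] delta_graded[OF Var_T_graded gd]] by simp
    moreover have "Var (X l) * (delta m (Var (T l')) (g r) - delta m 0 (g r)) \<in> ?M" for l m l' r
      by (intro X_graded delta_T_diff_graded gd)
    ultimately show ?thesis unfolding eq by (intro graded_add graded_diff) blast+
  qed
  \<comment> \<open>Split p at the indices j and j + 1. Outside them \<open>swap\<close> turns
    differences in direction j of varying g_i into differences in varying directions of the fixed
    g_(j+1) or g_j, and these telescope.\<close>
  have delta_p: "delta j 0 p - (Var (X j) * g j - Var (X j) * R (g (Suc j))) \<in> ?M" if j: "1 \<le> j" for j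
  proof -
    \<comment> \<open>Large enough that the sum covers all nonzero g_i, that both split indices lie
      in range, and that inserting at position L leaves g_j unchanged.\<close>
    define L where "L = N + j + 2"
    let ?a = "\<lambda>i. Var (X i) * g i"
    have "p = (\<Sum>i = 1..<Suc L. ?a i)"
      unfolding p_def by (rule sum.mono_neutral_left) (auto simp: L_def g0)
    also have "\<dots> = (\<Sum>i = 1..<j. ?a i) + (\<Sum>i = j..<Suc L. ?a i)"
      using j by (intro sum.atLeastLessThan_concat[symmetric]) (auto simp: L_def)
    also have "(\<Sum>i = j..<Suc L. ?a i) = ?a j + (\<Sum>i = j..<L. ?a (Suc i))"
      by (subst sum.atLeast_Suc_lessThan) (simp_all add: L_def sum.shift_bounds_Suc_ivl del: sum.op_ivl_Suc)
    also have "(\<Sum>i = j..<L. ?a (Suc i)) = ?a (Suc j) + (\<Sum>i = Suc j..<L. ?a (Suc i))"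
      by (subst sum.atLeast_Suc_lessThan) (simp_all add: L_def del: sum.op_ivl_Suc)
    finally have p_split: "p = (\<Sum>i = 1..<j. ?a i) + (?a j + (?a (Suc j) + (\<Sum>i = Suc j..<L. ?a (Suc i))))" .
    have low: "delta j 0 (\<Sum>i = 1..<j. ?a i) = (\<Sum>i = 1..<j. Var (X i) * delta j 0 (g i))"
      unfolding delta_sum
      by (intro sum.cong refl delta_mult_left) (auto simp: ins_Var ins_var_def)
    have high: "delta j 0 (\<Sum>i = Suc j..<L. ?a (Suc i)) =
        (\<Sum>i = Suc j..<L. Var (X i) * delta j 0 (g (Suc i)))"
      unfolding delta_sum
      by (intro sum.cong refl delta_mult_left) (auto simp: ins_Var ins_var_def)
    have mid: "delta j 0 (?a j) = Var (X j) * ins (Suc j) 0 (g j)"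
      "delta j 0 (?a (Suc j)) = - (Var (X j) * ins j 0 (g (Suc j)))"
      by (simp_all add: delta_def ins_Var ins_var_def)
    have low': "(\<Sum>i = 1..<j. Var (X j) * delta i 0 (g (Suc j))) =
        Var (X j) * (ins j 0 (g (Suc j)) - R (g (Suc j)))"
      using j by (simp add: sum_delta_0 R_def flip: sum_distrib_left)
    have high': "(\<Sum>i = Suc j..<L. Var (X j) * delta i 0 (g j)) =
        Var (X j) * (g j - ins (Suc j) 0 (g j))"
      using sum_delta_0[of "Suc j" L "g j"] ins_beyond[OF gx[of j], of L 0]
      by (simp add: L_def flip: sum_distrib_left)
    have "delta j 0 p - (Var (X j) * g j - Var (X j) * R (g (Suc j))) =
        (\<Sum>i = 1..<j. Var (X i) * delta j 0 (g i) - Var (X j) * delta i 0 (g (Suc j))) -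
        (\<Sum>i = Suc j..<L. Var (X j) * delta i 0 (g j) - Var (X i) * delta j 0 (g (Suc i)))"
      unfolding p_split delta_add low high mid sum_subtractf low' high'
      by (simp add: algebra_simps)
    also have "\<dots> \<in> ?M"
      using j by (intro graded_diff graded_sum swap) auto
    finally show ?thesis .
  qed
  \<comment> \<open>The defect of f in the t = 0 equations. Modulo higher t-degree u_j equals R
    u_(j+1), and u_j vanishes for j > N, so descending induction shows that it has higher
    t-degree.\<close>
  define u where "u j = delta j 0 f - Var (X j) * g j" for j
  have u_step: "u j - R (u (Suc j)) \<in> ?M" if j: "1 \<le> j" for j
  proof -
    have "delta j 0 (R f) = R (delta (Suc j) 0 f)"
      using j ins_ins[of 1 j 0 0 f] ins_ins[of 1 "Suc j" 0 0 f] by (simp add: delta_def R_def)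
    then have "u j - R (u (Suc j)) = delta j 0 (f - R f) - (Var (X j) * g j - Var (X j) * R (g (Suc j)))"
      using j by (simp add: u_def delta_diff R_hom R_X)
    then show ?thesis using delta_p[OF j] by (simp add: f_R)
  qed
  have u_graded: "u j \<in> ?M" if "1 \<le> j" for j
    using that
  proof (induction "Suc N - j" arbitrary: j)
    case 0
    then show ?case using f_xn by (simp add: u_def delta_beyond g0)
  next
    case (Suc l)
    then have "R (u (Suc j)) \<in> ?M" by (intro R_graded) simp
    from graded_add[OF u_step[OF Suc.prems] this] show ?case by simp
  qed
  have "Ediv i f - g i \<in> graded d (Suc k)" if i: "1 \<le> i" for i
  proof (rule Var_mult_graded_cancel)
    \<comment> \<open>Return from t = 0 to E_i: each of the three summands has t-degree at least k +
      1, and cancelling x_i keeps this bound.\<close>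
    have "Var (X i) * (Ediv i f - g i) =
        (delta i (Var (T i)) f - delta i 0 f) + Var (T i) * Ediv i f + u i"
      by (simp add: delta_eq_Ediv u_def algebra_simps)
    moreover have "Var (T i) * Ediv i f \<in> ?M"
      using graded_mult[OF graded_Var[of "T i"] Ediv_graded[OF f_graded]] by simp
    ultimately show "Var (X i) * (Ediv i f - g i) \<in> ?M"
      using delta_T_diff_graded[OF f_graded] u_graded[OF i] by (auto intro!: graded_add)
  qed
  then show ?thesis using f_graded f_xn by blast
qed

text \<open>Induction on the number of t-degrees left. The remainder g_i - E_i f lies one step
  deeper in the filtration and satisfies the same hypotheses; once k exceeds d it is zero.\<close>

lemma antiderivative:
  assumes "\<And>i. g i \<in> graded d k" "\<And>i. g i \<in> poly_xn N" "\<And>i. N < i \<Longrightarrow> g i = 0" "compatible g"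
  shows "\<exists>f. f \<in> graded (Suc d) k \<and> f \<in> poly_xn N \<and> (\<forall>i\<ge>1. Ediv i f = g i)"
  using assms
proof (induction "Suc d - k" arbitrary: g k)
  case 0
  then have "g i = 0" for i using graded_empty[of "g i" d k] by simp
  then show ?case by (intro exI[of _ 0]) simp
next
  case (Suc e)
  obtain f where f: "f \<in> graded (Suc d) k" "f \<in> poly_xn N"
      "\<And>i. 1 \<le> i \<Longrightarrow> Ediv i f - g i \<in> graded d (Suc k)"
    using approximate_antiderivative[OF Suc.prems] by blast
  \<comment> \<open>The bounds on E_i f are available for i \<ge> 1, while the induction hypothesis
    asks for them at every index; hence the default 0 at index 0.\<close>
  define h where "h i = (if i = 0 then 0 else g i - Ediv i f)" for i
  have "\<exists>f'. f' \<in> graded (Suc d) (Suc k) \<and> f' \<in> poly_xn N \<and> (\<forall>i\<ge>1. Ediv i f' = h i)"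
  proof (rule Suc.hyps(1))
    show "e = Suc d - Suc k" using Suc.hyps(2) by simp
    show "h i \<in> graded d (Suc k)" for i
      using graded_uminus[OF f(3)[of i]] by (auto simp: h_def)
    show "h i \<in> poly_xn N" for i
      using Suc.prems(2) f(2) by (auto simp: h_def intro!: poly_xn_diff Ediv_poly_xn)
    show "h i = 0" if "N < i" for i
      using that Suc.prems(3) Ediv_beyond[OF f(2)] by (simp add: h_def)
    show "compatible h"
      using compatible_diff[OF Suc.prems(4) compatible_Ediv[of f]]
      by (simp add: compatible_def h_def)
  qed
  then obtain f' where f': "f' \<in> graded (Suc d) (Suc k)" "f' \<in> poly_xn N"
      "\<And>i. 1 \<le> i \<Longrightarrow> Ediv i f' = h i"
    by blast
  have "f + f' \<in> graded (Suc d) k"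
    using f(1) graded_mono[OF f'(1)] by (intro graded_add) auto
  moreover have "Ediv i (f + f') = g i" if "1 \<le> i" for i
    using that f'(3) by (simp add: Ediv_add h_def)
  ultimately show ?case using poly_xn_add[OF f(2) f'(2)] by blast
qed

text \<open>If x_N is the last variable and E_N f = 0, then inserting t_N at position N + 1, which
  changes nothing, agrees with inserting it at position N, which eliminates x_N. Repeat downwards to
  n.\<close>

lemma poly_xn_of_Ediv_eq_0:
  assumes "f \<in> poly_x" "\<And>i. n < i \<Longrightarrow> Ediv i f = 0"
  shows "f \<in> poly_xn n"
proof -
  obtain N where "f \<in> poly_xn N" using poly_x_poly_xn[OF assms(1)] .
  then show ?thesis
  proof (induction N)
    case 0
    then show ?case using poly_xn_mono by blast
  next
    case (Suc N)
    show ?case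
    proof (cases "Suc N \<le> n")
      case True
      then show ?thesis using Suc.prems poly_xn_mono by blast
    next
      case False
      then have "delta (Suc N) (Var (T (Suc N))) f = 0"
        using assms(2) by (simp add: delta_eq_Ediv)
      then have "f = ins (Suc N) (Var (T (Suc N))) f"
        using ins_beyond[OF Suc.prems] by (simp add: delta_def)
      also have "\<dots> \<in> poly_xn N"
        unfolding ins_def
        by (rule poly_xn_subst[OF Suc.prems])
          (auto simp: ins_var_def intro!: poly_xn_Var_X poly_xn_Var_T)
      finally show ?thesis by (rule Suc.IH)
    qed
  qed
qed

lemma eval_tt_eq_ev: "eval_tt = ev id"
  unfolding eval_tt_def ev_def by (intro arg_cong[where f = subst] ext) simp

lemma eval_tt_const:
  assumes "f \<in> poly_xn 0"
  shows "eval_tt f = f"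
proof -
  have "eval_tt f = subst Var f"
    unfolding eval_tt_def by (rule subst_cong) (use assms in \<open>auto simp: poly_xn_def\<close>)
  then show ?thesis by (simp add: subst_Var_id)
qed

lemma eval_tt_poly_xn: "f \<in> poly_xn n \<Longrightarrow> eval_tt f \<in> poly_xn 0"
  unfolding eval_tt_def by (rule poly_xn_subst) (auto intro!: poly_xn_Var_T)

lemma eval_tt_graded: "f \<in> graded d 0 \<Longrightarrow> eval_tt f \<in> graded d 0"
  unfolding eval_tt_def
  by (rule subst_graded)
    (use Var_T_graded graded_Var[of "T _"] in \<open>auto simp: weighted_subst_def split: var.split\<close>)

text \<open>Vanishing of all E_i removes every x-variable, and then evaluation at x = t is the
  identity. This is the source of uniqueness.\<close>

lemma eq_0_of_Ediv_eq_0: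
  assumes "f \<in> poly_x" "\<And>i. 1 \<le> i \<Longrightarrow> Ediv i f = 0" "eval_tt f = 0"
  shows "f = 0"
  using poly_xn_of_Ediv_eq_0[OF assms(1), of 0] assms(2,3) eval_tt_const[of f] by simp

text \<open>The value of f at x = t is free of x-variables, hence killed by every E_i, and may be
  subtracted.\<close>

lemma antiderivative_vanishing_at_t:
  assumes "\<And>i. g i \<in> graded d 0" "\<And>i. g i \<in> poly_xn N" "\<And>i. N < i \<Longrightarrow> g i = 0" "compatible g"
  shows "\<exists>f. f \<in> graded (Suc d) 0 \<and> f \<in> poly_x \<and> eval_tt f = 0 \<and> (\<forall>i\<ge>1. Ediv i f = g i)"
proof -
  obtain f where f: "f \<in> graded (Suc d) 0" "f \<in> poly_xn N" "\<And>i. 1 \<le> i \<Longrightarrow> Ediv i f = g i"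
    using antiderivative[OF assms] by blast
  let ?c = "eval_tt f"
  have c: "?c \<in> poly_xn 0" using f(2) by (rule eval_tt_poly_xn)
  have "eval_tt (f - ?c) = 0"
    using eval_tt_const[OF c] by (simp add: eval_tt_def)
  moreover have "Ediv i (f - ?c) = g i" if "1 \<le> i" for i
    using that f(3) Ediv_beyond[OF c, of i] by (simp add: Ediv_diff)
  moreover have "f - ?c \<in> poly_xn N"
    using f(2) poly_xn_mono[OF c] by (intro poly_xn_diff) auto
  ultimately show ?thesis
    using f(1) eval_tt_graded graded_diff poly_xn_poly_x by blast
qed

section \<open>Contraction and grafting of trees\<close>

lemma nleaves_pos [simp]: "0 < nleaves t"
  by (induction t) auto

text \<open>A uniform rule that replaces the overlapping patterns in the definition of
  \<open>terms\<close>.\<close>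

lemma terms_Nd_iff:
  "i \<in> terms a (Nd l r) \<longleftrightarrow> (l = Lf \<and> r = Lf \<and> i = a) \<or> i \<in> terms a l \<or> i \<in> terms (a + nleaves l) r"
  by (cases l; cases r) auto

lemma contract_Nd:
  "\<not> (l = Lf \<and> r = Lf) \<Longrightarrow> contract a i (Nd l r) = Nd (contract a i l) (contract (a + nleaves l) i r)"
  by (cases l; cases r) auto

declare terms.simps(2,3,4) [simp del] contract.simps(2,3,4) [simp del]

lemma contract_pair: "contract a i (Nd Lf Lf) = (if a = i then Lf else Nd Lf Lf)"
  by (simp add: contract.simps)

lemma terms_bounds: "i \<in> terms a t \<Longrightarrow> a \<le> i \<and> Suc i < a + nleaves t"
  by (induction t arbitrary: a) (fastforce simp: terms_Nd_iff)+

lemma terms_shift: "Suc i \<in> terms (Suc a) t \<longleftrightarrow> i \<in> terms a t"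
  by (induction t arbitrary: a) (auto simp: terms_Nd_iff)

lemma contract_notin: "i \<notin> terms a t \<Longrightarrow> contract a i t = t"
proof (induction t arbitrary: a)
  case (Nd l r)
  then show ?case
    by (cases "l = Lf \<and> r = Lf") (auto simp: contract_pair contract_Nd terms_Nd_iff)
qed simp

lemma contract_shift: "contract (Suc a) (Suc i) t = contract a i t"
proof (induction t arbitrary: a)
  case (Nd l r)
  from Nd(1)[of a] Nd(2)[of "a + nleaves l"] show ?case
    by (cases "l = Lf \<and> r = Lf") (auto simp: contract_pair contract_Nd)
qed simp

lemma contract_left:
  assumes "i \<in> terms a l"
  shows "contract a i (Nd l r) = Nd (contract a i l) r"
proof -
  have "i \<notin> terms (a + nleaves l) r" "l \<noteq> Lf"
    using terms_bounds[OF assms] terms_bounds[of i "a + nleaves l" r] assms by auto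
  then show ?thesis by (simp add: contract_Nd contract_notin)
qed

lemma contract_right:
  assumes "i \<in> terms (a + nleaves l) r"
  shows "contract a i (Nd l r) = Nd l (contract (a + nleaves l) i r)"
proof -
  have "i \<notin> terms a l" "r \<noteq> Lf"
    using terms_bounds[OF assms] terms_bounds[of i a l] assms by auto
  then show ?thesis by (simp add: contract_Nd contract_notin)
qed

lemma terms_cases [consumes 1, case_names pair left right]:
  assumes "i \<in> terms a (Nd l r)"
  obtains "l = Lf" "r = Lf" "i = a" | "i \<in> terms a l" | "i \<in> terms (a + nleaves l) r"
  using assms by (auto simp: terms_Nd_iff)

lemma nleaves_contract: "i \<in> terms a t \<Longrightarrow> nleaves t = Suc (nleaves (contract a i t))"
proof (induction t arbitrary: a)
  case (Nd l r)
  from Nd.prems show ?case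
  proof (cases rule: terms_cases)
    case left
    then show ?thesis using Nd.IH(1) by (simp add: contract_left)
  next
    case right
    then show ?thesis using Nd.IH(2) by (simp add: contract_right)
  qed (simp add: contract_pair)
qed simp

text \<open>Contraction at i removes one leaf, so later labels drop by one. A node that becomes
  terminal has label i - 1 or i, so nothing new appears above i.\<close>

lemma terms_contract_above:
  assumes "i \<in> terms a t" "i < j"
  shows "j \<in> terms a (contract a i t) \<longleftrightarrow> Suc j \<in> terms a t"
  using assms(1)
proof (induction t arbitrary: a)
  case (Nd l r)
  from Nd.prems show ?case
  proof (cases rule: terms_cases)
    case pair
    then show ?thesis using assms(2) by (auto simp: contract_pair terms_Nd_iff)
  next
    case left
    have "a \<le> i" using terms_bounds[OF left] by simp
    then show ?thesis
      using Nd.IH(1)[OF left] nleaves_contract[OF left] assms(2) left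
        terms_shift[of j "a + nleaves (contract a i l)" r]
      by (auto simp: contract_left terms_Nd_iff)
  next
    case right
    then have "a + nleaves l \<le> i" using terms_bounds by blast
    moreover from this have "j \<notin> terms a l" "Suc j \<notin> terms a l"
      using terms_bounds[of _ a l] assms(2) by fastforce+
    ultimately show ?thesis
      using Nd.IH(2)[OF right] assms(2) right
      by (auto simp: contract_right terms_Nd_iff)
  qed
qed simp

text \<open>A node made terminal by contraction at j + 1 has label j or j + 1, which i < j
  excludes.\<close>

lemma terms_contract_below:
  assumes "Suc j \<in> terms a t" "i < j"
  shows "i \<in> terms a (contract a (Suc j) t) \<longleftrightarrow> i \<in> terms a t"
  using assms(1)
proof (induction t arbitrary: a)
  case (Nd l r)
  from Nd.prems show ?case
  proof (cases rule: terms_cases)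
    case pair
    then show ?thesis using assms(2) by (auto simp: contract_pair terms_Nd_iff)
  next
    case left
    let ?l = "contract a (Suc j) l"
    note b = terms_bounds[OF left] and n = nleaves_contract[OF left]
    have "i \<notin> terms (a + nleaves ?l) r" "i \<notin> terms (a + nleaves l) r"
      using b n assms(2) terms_bounds[of i _ r] by fastforce+
    moreover have "\<not> (?l = Lf \<and> i = a)" using b n assms(2) by auto
    ultimately show ?thesis
      using Nd.IH(1)[OF left] left by (auto simp: contract_left terms_Nd_iff)
  next
    case right
    let ?r = "contract (a + nleaves l) (Suc j) r"
    note b = terms_bounds[OF right] and n = nleaves_contract[OF right]
    have "\<not> (?r = Lf \<and> l = Lf \<and> i = a)" using b n assms(2) by auto
    then show ?thesis
      using Nd.IH(2)[OF right] right by (auto simp: contract_right terms_Nd_iff)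
  qed
qed simp

text \<open>Two terminal nodes can be removed in either order; the right one changes its label from
  j + 1 to j once the left one is gone.\<close>

lemma contract_contract:
  assumes "i \<in> terms a t" "Suc j \<in> terms a t" "i < j"
  shows "contract a j (contract a i t) = contract a i (contract a (Suc j) t)"
  using assms(1,2)
proof (induction t arbitrary: a)
  case (Nd l r)
  from Nd.prems(1) show ?case
  proof (cases rule: terms_cases)
    case pair
    then show ?thesis using Nd.prems(2) assms(3) by (auto simp: terms_Nd_iff)
  next
    case il: left
    note ni = nleaves_contract[OF il]
    from Nd.prems(2) show ?thesis
    proof (cases rule: terms_cases)
      case pair
      then show ?thesis using il by auto
    next
      case jl: left
      have "j \<in> terms a (contract a i l)" "i \<in> terms a (contract a (Suc j) l)"
        using terms_contract_above[OF il assms(3)] terms_contract_below[OF jl assms(3)] il jl by auto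
      then show ?thesis using il jl Nd.IH(1) by (simp add: contract_left)
    next
      case jr: right
      have "j \<in> terms (a + nleaves (contract a i l)) r"
        using jr terms_shift[of j "a + nleaves (contract a i l)" r] ni by simp
      then show ?thesis
        using il jr ni contract_shift[of "a + nleaves (contract a i l)" j r]
        by (simp add: contract_left contract_right)
    qed
  next
    case ir: right
    note bi = terms_bounds[OF ir]
    from Nd.prems(2) show ?thesis
    proof (cases rule: terms_cases)
      case pair
      then show ?thesis using ir by auto
    next
      case left
      then show ?thesis using bi terms_bounds[OF left] assms(3) by linarith
    next
      case jr: right
      let ?a = "a + nleaves l"
      have "j \<in> terms ?a (contract ?a i r)" "i \<in> terms ?a (contract ?a (Suc j) r)"
        using terms_contract_above[OF ir assms(3)] terms_contract_below[OF jr assms(3)] ir jr by auto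
      then show ?thesis using ir jr Nd.IH(2) by (simp add: contract_right)
    qed
  qed
qed simp

text \<open>The inverse of \<open>contract\<close>: leaf i grows into a terminal node. It serves
  both to reconstruct a forest from a quotient and to build one with a prescribed code.\<close>

fun graft :: "nat \<Rightarrow> nat \<Rightarrow> tree \<Rightarrow> tree" where
  "graft a i Lf = (if a = i then Nd Lf Lf else Lf)"
| "graft a i (Nd l r) = Nd (graft a i l) (graft (a + nleaves l) i r)"

lemma graft_outside: "\<not> (a \<le> i \<and> i < a + nleaves t) \<Longrightarrow> graft a i t = t"
  by (induction t arbitrary: a) auto

lemma contract_graft:
  "a \<le> i \<Longrightarrow> i < a + nleaves t \<Longrightarrow> i \<in> terms a (graft a i t) \<and> contract a i (graft a i t) = t"
proof (induction t arbitrary: a)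
  case Lf
  then show ?case by (simp add: terms_Nd_iff contract_pair)
next
  case (Nd l r)
  show ?case
  proof (cases "i < a + nleaves l")
    case True
    then have "graft (a + nleaves l) i r = r" by (intro graft_outside) simp
    then show ?thesis
      using Nd.IH(1)[of a] Nd.prems True by (auto simp: terms_Nd_iff contract_left)
  next
    case False
    then have "graft a i l = l" by (intro graft_outside) simp
    then show ?thesis
      using Nd.IH(2)[of "a + nleaves l"] Nd.prems False by (auto simp: terms_Nd_iff contract_right)
  qed
qed

lemma graft_contract: "i \<in> terms a t \<Longrightarrow> graft a i (contract a i t) = t"
proof (induction t arbitrary: a)
  case (Nd l r)
  from Nd.prems show ?case
  proof (cases rule: terms_cases)
    case left
    note terms_bounds[OF left] nleaves_contract[OF left]
    moreover from this have "graft (a + nleaves (contract a i l)) i r = r"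
      by (intro graft_outside) auto
    ultimately show ?thesis using Nd.IH(1) left by (simp add: contract_left)
  next
    case right
    note terms_bounds[OF right]
    moreover from this have "graft a i l = l" by (intro graft_outside) auto
    ultimately show ?thesis using Nd.IH(2) right by (simp add: contract_right)
  qed (simp add: contract_pair)
qed simp

section \<open>Multisets of leftmost-leaf labels\<close>

lemma rhos_bounds: "x \<in># rhos a t \<Longrightarrow> a \<le> x \<and> Suc x < a + nleaves t"
proof (induction t arbitrary: a)
  case (Nd l r)
  then consider "x = a" | "x \<in># rhos a l" | "x \<in># rhos (a + nleaves l) r" by auto
  then show ?case
    using Nd.IH nleaves_pos[of l] nleaves_pos[of r] by cases (fastforce simp del: nleaves_pos)+
qed simp

lemma rhos_shift: "rhos (Suc a) t = image_mset Suc (rhos a t)"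
proof (induction t arbitrary: a)
  case (Nd l r)
  from Nd(1)[of a] Nd(2)[of "a + nleaves l"] show ?case by simp
qed simp

text \<open>Relabeling of leaves when leaf i is replaced by a terminal node; the omitted value i + 1
  is the right leaf of that node.\<close>

definition bump :: "nat \<Rightarrow> nat \<Rightarrow> nat" where
  "bump i x = (if x \<le> i then x else Suc x)"

lemma image_bump_id: "(\<And>x. x \<in># M \<Longrightarrow> x \<le> i) \<Longrightarrow> image_mset (bump i) M = M"
  by (induction M) (auto simp: bump_def)

lemma image_bump_Suc:
  assumes "\<And>x. x \<in># M \<Longrightarrow> i < x"
  shows "image_mset (bump i) M = image_mset Suc M"
  by (rule image_mset_cong) (use assms in \<open>simp add: bump_def not_le\<close>)

lemma rhos_contract:
  "i \<in> terms a t \<Longrightarrow> rhos a t = add_mset i (image_mset (bump i) (rhos a (contract a i t)))"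
proof (induction t arbitrary: a)
  case (Nd l r)
  from Nd.prems show ?case
  proof (cases rule: terms_cases)
    case left
    let ?l = "contract a i l"
    note b = terms_bounds[OF left] and n = nleaves_contract[OF left]
    have "i < x" if "x \<in># rhos (a + nleaves ?l) r" for x
      using rhos_bounds[OF that] b n by linarith
    then have "image_mset (bump i) (rhos (a + nleaves ?l) r) = rhos (a + nleaves l) r"
      using n by (simp add: image_bump_Suc rhos_shift)
    moreover have "bump i a = a" using b by (simp add: bump_def)
    ultimately show ?thesis using left Nd.IH(1)[OF left] by (simp add: contract_left)
  next
    case right
    note b = terms_bounds[OF right]
    have "x \<le> i" if "x \<in># rhos a l" for x
      using rhos_bounds[OF that] b by linarith
    then have "image_mset (bump i) (rhos a l) = rhos a l" by (rule image_bump_id)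
    moreover have "bump i a = a" using b by (simp add: bump_def)
    ultimately show ?thesis using right Nd.IH(2)[OF right] by (simp add: contract_right)
  qed (simp add: contract_pair)
qed simp

text \<open>An internal right child would carry a larger label, while an internal left child carries
  the same one; descending therefore ends at a terminal node labelled i.\<close>

lemma Max_rhos_terminal:
  assumes "i \<in># rhos a t" "\<And>x. x \<in># rhos a t \<Longrightarrow> x \<le> i"
  shows "i \<in> terms a t"
  using assms
proof (induction t arbitrary: a)
  case (Nd l r)
  show ?case
  proof (cases r)
    case (Nd r1 r2)
    then have "a + nleaves l \<le> i" using Nd.prems(2)[of "a + nleaves l"] by simp
    then have "i \<notin># rhos a l" "i \<noteq> a"
      using rhos_bounds[of i a l] nleaves_pos[of l] by fastforce+
    then have "i \<in># rhos (a + nleaves l) r" using Nd.prems(1) by simp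
    then show ?thesis using Nd.IH(2) Nd.prems(2) by (simp add: terms_Nd_iff)
  next
    case r: Lf
    show ?thesis
    proof (cases l)
      case Lf
      then show ?thesis using r Nd.prems(1) by (simp add: terms_Nd_iff)
    next
      case (Nd l1 l2)
      then have "i \<in># rhos a l" using r Nd.prems(1) by auto
      then show ?thesis using Nd.IH(1) Nd.prems(2) by (simp add: terms_Nd_iff)
    qed
  qed
qed simp

section \<open>Indexed forests and their codes\<close>

lemma offset_Suc: "offset F (Suc k) = offset F k + nleaves (F k)"
  by (simp add: offset_def)

lemma offset_less: "k < m \<Longrightarrow> offset F k + nleaves (F k) \<le> offset F m"
  by (induction m) (auto simp: offset_Suc less_Suc_eq)

lemma offset_ge: "k < offset F k"
proof (induction k)
  case (Suc k)
  then show ?case using nleaves_pos[of "F k"] unfolding offset_Suc by linarith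
qed (simp add: offset_def)

lemma offset_upd_le: "m \<le> k \<Longrightarrow> offset (F(k := t)) m = offset F m"
  by (simp add: offset_def)

lemma offset_upd_gt:
  assumes "k < m"
  shows "offset (F(k := t)) m + nleaves (F k) = offset F m + nleaves t"
proof -
  have "(\<Sum>j\<in>{..<m} - {k}. nleaves ((F(k := t)) j)) = (\<Sum>j\<in>{..<m} - {k}. nleaves (F j))"
    by (rule sum.cong) auto
  then show ?thesis
    using assms sum.remove[of "{..<m}" k "\<lambda>j. nleaves (F j)"]
      sum.remove[of "{..<m}" k "\<lambda>j. nleaves ((F(k := t)) j)"]
    by (simp add: offset_def)
qed

lemma offset_range_unique:
  assumes "offset F k \<le> i" "i < offset F k + nleaves (F k)"
    and "offset F m \<le> i" "i < offset F m + nleaves (F m)"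
  shows "k = m"
proof (rule linorder_cases[of k m])
  assume "k < m" then show ?thesis using offset_less[of k m F] assms by linarith
next
  assume "m < k" then show ?thesis using offset_less[of m k F] assms by linarith
qed

lemma tree_of_leaf:
  assumes "1 \<le> i"
  obtains k where "offset F k \<le> i" "i < offset F k + nleaves (F k)"
proof -
  define k where "k = (LEAST k. i < offset F (Suc k))"
  have "i < offset F (Suc i)" using offset_ge[of "Suc i" F] by simp
  then have k: "i < offset F (Suc k)" unfolding k_def by (rule LeastI)
  have "offset F k \<le> i"
  proof (cases k)
    case 0
    then show ?thesis using assms by (simp add: offset_def)
  next
    case (Suc k')
    then show ?thesis using not_less_Least[of k' "\<lambda>k. i < offset F (Suc k)"] k_def by simp
  qed
  then show thesis using that k by (simp add: offset_Suc)
qed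

lemma Qdes_iff: "i \<in> Qdes F \<longleftrightarrow> (\<exists>k. i \<in> terms (offset F k) (F k))"
  by (simp add: Qdes_def)

lemma terms_tree_unique:
  assumes "i \<in> terms (offset F k) (F k)" "i \<in> terms (offset F m) (F m)"
  shows "k = m"
  using terms_bounds[OF assms(1)] terms_bounds[OF assms(2)]
  by (intro offset_range_unique[of F k i m]) auto

text \<open>Although \<open>forest_quot\<close> contracts in every tree, the label ranges of
  distinct trees are disjoint, so only one tree is affected.\<close>

lemma forest_quot_eq_upd:
  assumes "i \<in> terms (offset F k) (F k)"
  shows "forest_quot F i = F(k := contract (offset F k) i (F k))"
proof
  fix m show "forest_quot F i m = (F(k := contract (offset F k) i (F k))) m"
    using terms_tree_unique[OF assms, of m] contract_notin[of i "offset F m" "F m"]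
    by (cases "m = k") (auto simp: forest_quot_def)
qed

lemma offset_forest_quot:
  assumes "i \<in> terms (offset F k) (F k)"
  shows "m \<le> k \<Longrightarrow> offset (forest_quot F i) m = offset F m"
    and "k < m \<Longrightarrow> offset F m = Suc (offset (forest_quot F i) m)"
  using offset_upd_le[of m k F] offset_upd_gt[of k m F "contract (offset F k) i (F k)"]
    nleaves_contract[OF assms]
  by (simp_all add: forest_quot_eq_upd[OF assms])

lemma Qdes_forest_quot_above:
  assumes "i \<in> Qdes F" "i < j"
  shows "j \<in> Qdes (forest_quot F i) \<longleftrightarrow> Suc j \<in> Qdes F"
proof -
  obtain k where k: "i \<in> terms (offset F k) (F k)" using assms(1) by (auto simp: Qdes_iff)
  have "j \<in> terms (offset (forest_quot F i) m) (forest_quot F i m) \<longleftrightarrow>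
      Suc j \<in> terms (offset F m) (F m)" for m
  proof (rule linorder_cases[of m k])
    assume m: "m < k"
    then have "j \<notin> terms (offset F m) (F m)" "Suc j \<notin> terms (offset F m) (F m)"
      using terms_bounds[OF k] terms_bounds[of _ "offset F m" "F m"] offset_less[OF m, of F] assms(2)
      by fastforce+
    then show ?thesis using m offset_forest_quot(1)[OF k, of m] by (simp add: forest_quot_eq_upd[OF k])
  next
    assume "m = k"
    then show ?thesis
      using terms_contract_above[OF k assms(2)] offset_forest_quot(1)[OF k, of m]
      by (simp add: forest_quot_eq_upd[OF k])
  next
    assume "k < m"
    then show ?thesis
      using offset_forest_quot(2)[OF k, of m] terms_shift[of j "offset (forest_quot F i) m" "F m"]
      by (simp add: forest_quot_eq_upd[OF k])
  qed
  then show ?thesis by (simp add: Qdes_iff)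
qed

lemma Qdes_forest_quot_below:
  assumes "Suc j \<in> Qdes F" "i < j"
  shows "i \<in> Qdes (forest_quot F (Suc j)) \<longleftrightarrow> i \<in> Qdes F"
proof -
  obtain k where k: "Suc j \<in> terms (offset F k) (F k)" using assms(1) by (auto simp: Qdes_iff)
  have "i \<in> terms (offset (forest_quot F (Suc j)) m) (forest_quot F (Suc j) m) \<longleftrightarrow>
      i \<in> terms (offset F m) (F m)" for m
  proof (rule linorder_cases[of m k])
    assume "m < k"
    then show ?thesis using offset_forest_quot(1)[OF k, of m] by (simp add: forest_quot_eq_upd[OF k])
  next
    assume "m = k"
    then show ?thesis
      using terms_contract_below[OF k assms(2)] offset_forest_quot(1)[OF k, of m]
      by (simp add: forest_quot_eq_upd[OF k])
  next
    assume m: "k < m"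
    have "i \<notin> terms (offset F m) (F m)" "i \<notin> terms (offset (forest_quot F (Suc j)) m) (F m)"
      using terms_bounds[OF k] terms_bounds[of i _ "F m"] offset_less[OF m, of F] assms(2)
        offset_forest_quot(2)[OF k m] by fastforce+
    then show ?thesis using m by (simp add: forest_quot_eq_upd[OF k])
  qed
  then show ?thesis by (simp add: Qdes_iff)
qed

text \<open>The combinatorial counterpart of E_j E_i = E_i E_(j+1). It makes the right-hand sides of
  the recursion for forest polynomials compatible.\<close>

lemma forest_quot_forest_quot:
  assumes "i \<in> Qdes F" "Suc j \<in> Qdes F" "i < j"
  shows "forest_quot (forest_quot F i) j = forest_quot (forest_quot F (Suc j)) i"
proof -
  obtain k where k: "i \<in> terms (offset F k) (F k)" using assms(1) by (auto simp: Qdes_iff)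
  obtain m where m: "Suc j \<in> terms (offset F m) (F m)" using assms(2) by (auto simp: Qdes_iff)
  have "\<not> m < k"
    using offset_less[of m k F] terms_bounds[OF k] terms_bounds[OF m] assms(3) by linarith
  then consider "m = k" | "k < m" by linarith
  then show ?thesis
  proof cases
    case 1
    let ?a = "offset F k"
    have "j \<in> terms ?a (contract ?a i (F k))" "i \<in> terms ?a (contract ?a (Suc j) (F k))"
      using terms_contract_above[OF k assms(3)] terms_contract_below[of j ?a "F k" i] m k 1 assms(3)
      by auto
    then show ?thesis
      using k m 1 contract_contract[OF k _ assms(3)]
        forest_quot_eq_upd[of j "forest_quot F i" k] forest_quot_eq_upd[of i "forest_quot F (Suc j)" k]
      by (simp add: forest_quot_eq_upd[of _ _ k] offset_upd_le)
  next
    case 2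
    let ?F = "forest_quot F i" and ?G = "forest_quot F (Suc j)"
    \<comment> \<open>The nodes lie in different trees: contraction at i shifts the later tree by
      one leaf, so its label j + 1 becomes j.\<close>
    have off: "offset F m = Suc (offset ?F m)" using offset_forest_quot(2)[OF k 2] .
    have Fm: "?F m = F m" and Gk: "?G k = F k"
      using 2 by (simp_all add: forest_quot_eq_upd[OF k] forest_quot_eq_upd[OF m])
    have j: "j \<in> terms (offset ?F m) (?F m)"
      using m off terms_shift by (simp add: Fm)
    have i: "i \<in> terms (offset ?G k) (?G k)"
      using k offset_forest_quot(1)[OF m, of k] 2 by (simp add: Gk)
    have "forest_quot ?F j = F(k := contract (offset F k) i (F k), m := contract (offset F m) (Suc j) (F m))"
      using forest_quot_eq_upd[OF j] forest_quot_eq_upd[OF k] contract_shift off 2 by (simp add: Fm)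
    moreover have "forest_quot ?G i = F(m := contract (offset F m) (Suc j) (F m), k := contract (offset F k) i (F k))"
      using forest_quot_eq_upd[OF i] forest_quot_eq_upd[OF m] offset_forest_quot(1)[OF m, of k] 2
      by (simp add: Gk)
    ultimately show ?thesis using 2 by (simp add: fun_upd_twist)
  qed
qed

lemma indexed_forest_upd [simp]: "indexed_forest F \<Longrightarrow> indexed_forest (F(k := t))"
  unfolding indexed_forest_def
  by (rule finite_subset[of _ "insert k {k. F k \<noteq> Lf}"]) auto

lemma indexed_forest_quot: "indexed_forest F \<Longrightarrow> i \<in> Qdes F \<Longrightarrow> indexed_forest (forest_quot F i)"
  using forest_quot_eq_upd by (auto simp: Qdes_iff)

text \<open>The code as a finite multiset; its size, the number of internal nodes, drives the
  inductions on forests.\<close>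

definition forest_rhos :: "(nat \<Rightarrow> tree) \<Rightarrow> nat multiset" where
  "forest_rhos F = (\<Sum>k | F k \<noteq> Lf. rhos (offset F k) (F k))"

lemma code_eq_count: "code F = count (forest_rhos F)"
  by (simp add: fun_eq_iff code_def forest_rhos_def count_sum)

lemma forest_rhos_superset:
  assumes "finite A" "{k. F k \<noteq> Lf} \<subseteq> A"
  shows "forest_rhos F = (\<Sum>k\<in>A. rhos (offset F k) (F k))"
  unfolding forest_rhos_def by (rule sum.mono_neutral_left) (use assms in auto)

lemma in_forest_rhos:
  assumes "indexed_forest F"
  shows "x \<in># forest_rhos F \<longleftrightarrow> (\<exists>k. x \<in># rhos (offset F k) (F k))"
proof -
  have "x \<in># (\<Sum>k\<in>A. M k) \<longleftrightarrow> (\<exists>k\<in>A. x \<in># M k)" if "finite A" for A and M :: "nat \<Rightarrow> nat multiset"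
    using that by induction auto
  then show ?thesis using assms by (force simp: forest_rhos_def indexed_forest_def)
qed

text \<open>The removed node contributes i. Labels in trees to the left are at most i and stay fixed
  under \<open>bump i\<close>; those in trees to the right shift by one.\<close>

lemma forest_rhos_quot:
  assumes F: "indexed_forest F" and i: "i \<in> Qdes F"
  shows "forest_rhos F = add_mset i (image_mset (bump i) (forest_rhos (forest_quot F i)))"
proof -
  obtain k where k: "i \<in> terms (offset F k) (F k)" using i by (auto simp: Qdes_iff)
  let ?G = "forest_quot F i"
  define A where "A = {k. F k \<noteq> Lf}"
  have A: "finite A" "k \<in> A"
    using F k by (auto simp: A_def indexed_forest_def)
  have "{k. ?G k \<noteq> Lf} \<subseteq> A"
    using A(2) by (auto simp: forest_quot_eq_upd[OF k] A_def)
  then have G: "forest_rhos ?G = (\<Sum>m\<in>A. rhos (offset ?G m) (?G m))"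
    by (rule forest_rhos_superset[OF A(1)])
  have image_sum: "image_mset h (\<Sum>m\<in>B. M m) = (\<Sum>m\<in>B. image_mset h (M m))" if "finite B"
    for h :: "nat \<Rightarrow> nat" and B and M :: "nat \<Rightarrow> nat multiset"
    using that by induction auto
  have other: "image_mset (bump i) (rhos (offset ?G m) (?G m)) = rhos (offset F m) (F m)" if "m \<noteq> k" for m
  proof (cases "m < k")
    case True
    have "x \<le> i" if "x \<in># rhos (offset F m) (F m)" for x
      using rhos_bounds[OF that] offset_less[OF True, of F] terms_bounds[OF k] by linarith
    then show ?thesis
      using True offset_forest_quot(1)[OF k, of m]
      by (simp add: forest_quot_eq_upd[OF k] image_bump_id)
  next
    case False
    then have m: "k < m" using that by simp
    note off = offset_forest_quot(2)[OF k m]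
    have "i < x" if "x \<in># rhos (offset ?G m) (F m)" for x
      using rhos_bounds[OF that] offset_less[OF m, of F] terms_bounds[OF k] off by linarith
    then show ?thesis
      using that off by (simp add: forest_quot_eq_upd[OF k] image_bump_Suc rhos_shift)
  qed
  have at_k: "rhos (offset F k) (F k) = add_mset i (image_mset (bump i) (rhos (offset ?G k) (?G k)))"
    using rhos_contract[OF k] offset_forest_quot(1)[OF k, of k] by (simp add: forest_quot_eq_upd[OF k])
  have "forest_rhos F = rhos (offset F k) (F k) + (\<Sum>m\<in>A - {k}. rhos (offset F m) (F m))"
    unfolding forest_rhos_def A_def[symmetric] using A by (rule sum.remove)
  also have "\<dots> = add_mset i (image_mset (bump i) (rhos (offset ?G k) (?G k)) +
      (\<Sum>m\<in>A - {k}. image_mset (bump i) (rhos (offset ?G m) (?G m))))"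
    using other by (simp add: at_k)
  also have "\<dots> = add_mset i (image_mset (bump i) (forest_rhos ?G))"
    unfolding G image_sum[OF A(1)] by (simp add: sum.remove[OF A])
  finally show ?thesis .
qed

lemma Max_forest_rhos_Qdes:
  assumes "indexed_forest F" "i \<in># forest_rhos F" "\<And>x. x \<in># forest_rhos F \<Longrightarrow> x \<le> i"
  shows "i \<in> Qdes F"
proof -
  obtain k where "i \<in># rhos (offset F k) (F k)"
    using assms(1,2) in_forest_rhos by blast
  then have "i \<in> terms (offset F k) (F k)"
    using assms(1,3) in_forest_rhos by (intro Max_rhos_terminal) blast+
  then show ?thesis by (auto simp: Qdes_iff)
qed

lemma forest_rhos_empty_iff:
  assumes "indexed_forest F"
  shows "forest_rhos F = {#} \<longleftrightarrow> F = empty_forest"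
proof
  assume *: "forest_rhos F = {#}"
  have "F k = Lf" for k
  proof (rule ccontr)
    assume "F k \<noteq> Lf"
    then have "offset F k \<in># rhos (offset F k) (F k)" by (cases "F k") auto
    then show False using * in_forest_rhos[OF assms] by auto
  qed
  then show "F = empty_forest" by (simp add: empty_forest_def fun_eq_iff)
qed (simp add: forest_rhos_def empty_forest_def)

lemma forest_quot_inject:
  assumes "i \<in> Qdes F" "i \<in> Qdes G" "forest_quot F i = forest_quot G i"
  shows "F = G"
proof -
  \<comment> \<open>A left inverse of \<open>forest_quot\<close> at i that is the same for all
    forests with i in \<open>Qdes\<close>.\<close>
  define fgraft where "fgraft H = (\<lambda>k. graft (offset H k) i (H k))" for H
  have "fgraft (forest_quot F i) = F" if i: "i \<in> Qdes F" for F
  proof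
    fix m
    obtain k where k: "i \<in> terms (offset F k) (F k)" using i by (auto simp: Qdes_iff)
    note b = terms_bounds[OF k]
    show "fgraft (forest_quot F i) m = F m"
    proof (rule linorder_cases[of m k])
      assume m: "m < k"
      then have "graft (offset F m) i (F m) = F m"
        using b offset_less[OF m, of F] by (intro graft_outside) linarith
      then show ?thesis
        using m offset_forest_quot(1)[OF k, of m] by (simp add: fgraft_def forest_quot_eq_upd[OF k])
    next
      assume "m = k"
      then show ?thesis
        using graft_contract[OF k] offset_forest_quot(1)[OF k, of m]
        by (simp add: fgraft_def forest_quot_eq_upd[OF k])
    next
      assume m: "k < m"
      then have "graft (offset (forest_quot F i) m) i (F m) = F m"
        using b offset_less[OF m, of F] offset_forest_quot(2)[OF k m]
        by (intro graft_outside) linarith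
      then show ?thesis using m by (simp add: fgraft_def forest_quot_eq_upd[OF k])
    qed
  qed
  then show ?thesis using assms by metis
qed

lemma inj_bump: "inj (bump i)"
  by (auto simp: inj_def bump_def split: if_splits)

text \<open>The largest label belongs to a terminal node in both forests. Contract both there and
  use that \<open>bump\<close> and the quotient are injective.\<close>

lemma forest_rhos_inject:
  assumes "indexed_forest F" "indexed_forest G" "forest_rhos F = forest_rhos G"
  shows "F = G"
  using assms
proof (induction "size (forest_rhos F)" arbitrary: F G)
  case 0
  then show ?case using forest_rhos_empty_iff[of F] forest_rhos_empty_iff[of G] by simp
next
  case (Suc s)
  define i where "i = Max (set_mset (forest_rhos F))"
  have ne: "set_mset (forest_rhos F) \<noteq> {}" using Suc.hyps(2) by auto
  then have i: "i \<in># forest_rhos F" "\<And>x. x \<in># forest_rhos F \<Longrightarrow> x \<le> i"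
    unfolding i_def by (auto intro: Max_in)
  then have iF: "i \<in> Qdes F" and iG: "i \<in> Qdes G"
    using Suc.prems by (auto intro!: Max_forest_rhos_Qdes)
  have "image_mset (bump i) (forest_rhos (forest_quot F i)) = image_mset (bump i) (forest_rhos (forest_quot G i))"
    using forest_rhos_quot[OF Suc.prems(1) iF] forest_rhos_quot[OF Suc.prems(2) iG] Suc.prems(3) by simp
  then have eq: "forest_rhos (forest_quot F i) = forest_rhos (forest_quot G i)"
    using multiset.inj_map[OF inj_bump] by (meson injD)
  have "s = size (forest_rhos (forest_quot F i))"
    using Suc.hyps(2) forest_rhos_quot[OF Suc.prems(1) iF] by simp
  then have "forest_quot F i = forest_quot G i"
    using Suc.hyps(1) eq Suc.prems iF iG indexed_forest_quot by blast
  then show ?case using forest_quot_inject iF iG by blast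
qed

text \<open>Realize the multiset without its largest element i and graft at leaf i; no remaining
  label exceeds i, so the relabeling is trivial.\<close>

lemma forest_rhos_surj:
  assumes "\<And>x. x \<in># M \<Longrightarrow> 1 \<le> x"
  shows "\<exists>F. indexed_forest F \<and> forest_rhos F = M"
  using assms
proof (induction "size M" arbitrary: M)
  case 0
  then show ?case
    by (intro exI[of _ empty_forest]) (simp add: indexed_forest_def empty_forest_def forest_rhos_def)
next
  case (Suc s)
  define i where "i = Max (set_mset M)"
  have ne: "set_mset M \<noteq> {}" using Suc.hyps(2) by auto
  then have i: "i \<in># M" "\<And>x. x \<in># M \<Longrightarrow> x \<le> i"
    unfolding i_def by (auto intro: Max_in)
  then obtain M' where M: "M = add_mset i M'" by (meson mset_add)
  then have "\<exists>G. indexed_forest G \<and> forest_rhos G = M'"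
    using Suc.hyps Suc.prems by (intro Suc.hyps(1)) auto
  then obtain G where G: "indexed_forest G" "forest_rhos G = M'" by blast
  obtain k where k: "offset G k \<le> i" "i < offset G k + nleaves (G k)"
    using tree_of_leaf[of i G] Suc.prems i(1) by blast
  define F where "F = G(k := graft (offset G k) i (G k))"
  have offk: "offset F k = offset G k" by (simp add: F_def offset_upd_le)
  have iF: "i \<in> terms (offset F k) (F k)"
    using contract_graft[OF k] by (simp add: offk) (simp add: F_def)
  have "forest_quot F i = G"
    using contract_graft[OF k] forest_quot_eq_upd[OF iF] by (simp add: offk) (simp add: F_def)
  moreover have FI: "indexed_forest F" using G(1) by (simp add: F_def)
  moreover have "i \<in> Qdes F" using iF by (auto simp: Qdes_iff)
  ultimately have "forest_rhos F = add_mset i (image_mset (bump i) M')"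
    using forest_rhos_quot[of F i] G(2) by simp
  also have "image_mset (bump i) M' = M'" using i(2) M by (intro image_bump_id) auto
  finally show ?case using FI M by blast
qed

text \<open>Leaf i + 1 is the right child of the terminal node labelled i, so no path of left
  children from an internal node ends there.\<close>

lemma Qdes_code:
  assumes "indexed_forest F" "i \<in> Qdes F"
  shows "0 < code F i" "code F (Suc i) = 0"
proof -
  have "count (image_mset (bump i) N) (Suc i) = 0" for N
    by (rule count_eq_zero_iff[THEN iffD2]) (auto simp: bump_def split: if_splits)
  then show "0 < code F i" "code F (Suc i) = 0"
    using forest_rhos_quot[OF assms] by (simp_all add: code_eq_count)
qed

lemma forest_of_code_props:
  "indexed_forest (forest_of_code c) \<and>
   code (forest_of_code c) = (\<lambda>i. if 1 \<le> i \<and> i \<le> length c then c ! (i - 1) else 0)"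
proof -
  let ?c = "\<lambda>i. if 1 \<le> i \<and> i \<le> length c then c ! (i - 1) else 0"
  define M where "M = (\<Sum>i = 1..length c. replicate_mset (c ! (i - 1)) i)"
  have M: "count M = ?c"
    by (auto simp: fun_eq_iff M_def count_sum)
  then have "1 \<le> x" if "x \<in># M" for x
    using that by (metis count_eq_zero_iff)
  then obtain F where F: "indexed_forest F" "forest_rhos F = M"
    using forest_rhos_surj by blast
  have "\<exists>!F. indexed_forest F \<and> code F = ?c"
  proof (rule ex1I[of _ F])
    show "indexed_forest F \<and> code F = ?c"
      using F M by (simp add: code_eq_count)
    show "G = F" if "indexed_forest G \<and> code G = ?c" for G
    proof -
      have "count (forest_rhos G) = count M"
        using that unfolding code_eq_count M by blast
      then have "forest_rhos G = forest_rhos F" using F(2) by (simp only: count_inject)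
      then show ?thesis using forest_rhos_inject that F(1) by blast
    qed
  qed
  then show ?thesis unfolding forest_of_code_def by (rule theI')
qed

section \<open>Existence and uniqueness of double forest polynomials\<close>

lemma that_hom [simp]:
  "that m 0 = 0" "that m (p - q) = that m p - that m q" "that m (p * q) = that m p * that m q"
  by (simp_all add: that_def)

lemma that_Var [simp]:
  "that m (Var (X j)) = Var (X j)"
  "that m (Var (T j)) = Var (T (if j < m then j else Suc j))"
  by (simp_all add: that_def)

lemma ins_that: "ins j (that m a) (that m p) = that m (ins j a p)"
proof -
  let ?\<theta> = "\<lambda>v. case v of X j \<Rightarrow> Var (X j) | T j \<Rightarrow> if j < m then Var (T j) else Var (T (j + 1))"
  have "subst (ins_var j (subst ?\<theta> a)) (?\<theta> v) = subst ?\<theta> (ins_var j a v)" for v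
    by (auto simp: ins_var_def split: var.split)
  then show ?thesis by (simp add: ins_def that_def subst_subst)
qed

lemma delta_that: "delta j (that m a) (that m p) = that m (delta j a p)"
  by (simp add: delta_def ins_that)

text \<open>Both sides renumber the t-variables increasingly so as to omit t_i and t_(j+1).\<close>

lemma that_that:
  assumes "i < j"
  shows "that i (that j p) = that (Suc j) (that i p)"
  unfolding that_def subst_subst
  by (rule subst_cong) (use assms in \<open>auto split: var.split\<close>)

lemma that_poly_xn: "p \<in> poly_xn n \<Longrightarrow> that m p \<in> poly_xn n"
  unfolding that_def by (rule poly_xn_subst) (auto intro!: poly_xn_Var_X poly_xn_Var_T)

lemma that_graded: "p \<in> graded d k \<Longrightarrow> that m p \<in> graded d k"
  unfolding that_def
  by (rule subst_graded)
    (use graded_Var[of "X _"] graded_Var[of "T _"] in \<open>auto simp: weighted_subst_def split: var.split\<close>)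

text \<open>The number of internal nodes is a separate argument so that the recursion is primitive;
  the choice is justified by \<open>antiderivative_vanishing_at_t\<close>.\<close>

primrec forest_poly_rec :: "nat \<Rightarrow> (nat \<Rightarrow> tree) \<Rightarrow> poly" where
  "forest_poly_rec 0 F = 1"
| "forest_poly_rec (Suc d) F = (SOME f. f \<in> graded (Suc d) 0 \<and> f \<in> poly_x \<and> eval_tt f = 0 \<and>
     (\<forall>i\<ge>1. Ediv i f = (if i \<in> Qdes F then that i (forest_poly_rec d (forest_quot F i)) else 0)))"

lemma Qdes_in_rhos: "indexed_forest F \<Longrightarrow> i \<in> Qdes F \<Longrightarrow> i \<in># forest_rhos F"
  using Qdes_code(1) by (simp add: code_eq_count)

lemma size_forest_quot:
  "indexed_forest F \<Longrightarrow> i \<in> Qdes F \<Longrightarrow> size (forest_rhos F) = Suc (size (forest_rhos (forest_quot F i)))"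
  by (subst forest_rhos_quot) auto

lemma forest_poly_rec_props:
  assumes "indexed_forest F" "size (forest_rhos F) = d"
  shows "forest_poly_rec d F \<in> graded d 0 \<and> forest_poly_rec d F \<in> poly_x \<and>
    eval_tt (forest_poly_rec d F) = (if d = 0 then 1 else 0) \<and>
    (\<forall>i\<ge>1. Ediv i (forest_poly_rec d F) =
       (if i \<in> Qdes F then that i (forest_poly_rec (d - 1) (forest_quot F i)) else 0))"
  using assms
proof (induction d arbitrary: F)
  case 0
  then have "Qdes F = {}" using Qdes_in_rhos[of F] by auto
  moreover have "1 \<in> poly_xn 0" by (simp add: poly_xn_def)
  ultimately show ?case
    using Ediv_beyond[of 1 0] poly_xn_poly_x by (auto simp: eval_tt_def)
next
  case (Suc d)
  let ?P = "forest_poly_rec d"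
  define g where "g i = (if i \<in> Qdes F then that i (?P (forest_quot F i)) else 0)" for i
  have quot: "indexed_forest (forest_quot F i)" "size (forest_rhos (forest_quot F i)) = d"
    if "i \<in> Qdes F" for i
    using that indexed_forest_quot size_forest_quot Suc.prems by auto
  note IH = Suc.IH[OF quot]
  have "\<exists>n. g i \<in> poly_xn n" for i
  proof (cases "i \<in> Qdes F")
    case True
    then show ?thesis
      using IH[OF True True] that_poly_xn poly_x_poly_xn by (metis g_def)
  qed (simp add: g_def)
  then obtain n where n: "\<And>i. g i \<in> poly_xn (n i)" by metis
  have fin: "finite (Qdes F)"
    by (rule finite_subset[of _ "set_mset (forest_rhos F)"]) (use Qdes_in_rhos Suc.prems in auto)
  \<comment> \<open>A common bound for the indices of nonzero g_i and for the x-variables in them,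
    available because \<open>Qdes F\<close> is finite.\<close>
  define N where "N = (\<Sum>i\<in>Qdes F. i + n i)"
  have N: "i + n i \<le> N" if "i \<in> Qdes F" for i
    unfolding N_def using member_le_sum[OF that, of "\<lambda>i. i + n i"] fin by simp
  have "\<exists>f. f \<in> graded (Suc d) 0 \<and> f \<in> poly_x \<and> eval_tt f = 0 \<and> (\<forall>i\<ge>1. Ediv i f = g i)"
  proof (rule antiderivative_vanishing_at_t)
    show "g i \<in> graded d 0" for i
      using IH[of i] that_graded by (simp add: g_def)
    show "g i \<in> poly_xn N" for i
    proof (cases "i \<in> Qdes F")
      case True
      then show ?thesis using n[of i] N[OF True] poly_xn_mono by fastforce
    qed (simp add: g_def)
    show "g i = 0" if "N < i" for i
      using that N[of i] by (auto simp: g_def)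
    show "compatible g"
      unfolding compatible_def
    proof (intro allI impI)
      fix i j :: nat assume ij: "1 \<le> i" "i < j"
      \<comment> \<open>Since i < j, \<open>that i\<close> sends t_j to t_(j+1), so this difference
        is the image of one with respect to t_j, to which the induction hypothesis applies. The
        other side is treated alike, and the two double quotients agree.\<close>
      have L: "delta j (Var (T (Suc j))) (g i) =
          (if i \<in> Qdes F \<and> Suc j \<in> Qdes F
           then (Var (X j) - Var (T (Suc j))) * that i (that j (forest_poly_rec (d - 1) (forest_quot (forest_quot F i) j)))
           else 0)"
      proof (cases "i \<in> Qdes F")
        case True
        have "delta j (Var (T (Suc j))) (g i) = that i (delta j (Var (T j)) (?P (forest_quot F i)))"
          using ij True delta_that[of j i "Var (T j)"] by (simp add: g_def)
        also have "\<dots> = (Var (X j) - Var (T (Suc j))) * that i (Ediv j (?P (forest_quot F i)))"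
          using ij by (simp add: delta_eq_Ediv)
        also have "Ediv j (?P (forest_quot F i)) = (if Suc j \<in> Qdes F
            then that j (forest_poly_rec (d - 1) (forest_quot (forest_quot F i) j)) else 0)"
          using IH[OF True True] ij Qdes_forest_quot_above[OF True ij(2)] by simp
        finally show ?thesis using True by simp
      qed (simp add: g_def)
      have R: "delta i (Var (T i)) (g (Suc j)) =
          (if i \<in> Qdes F \<and> Suc j \<in> Qdes F
           then (Var (X i) - Var (T i)) * that (Suc j) (that i (forest_poly_rec (d - 1) (forest_quot (forest_quot F (Suc j)) i)))
           else 0)"
      proof (cases "Suc j \<in> Qdes F")
        case True
        have "delta i (Var (T i)) (g (Suc j)) = that (Suc j) (delta i (Var (T i)) (?P (forest_quot F (Suc j))))"
          using ij True delta_that[of i "Suc j" "Var (T i)"] by (simp add: g_def)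
        also have "\<dots> = (Var (X i) - Var (T i)) * that (Suc j) (Ediv i (?P (forest_quot F (Suc j))))"
          using ij by (simp add: delta_eq_Ediv)
        also have "Ediv i (?P (forest_quot F (Suc j))) = (if i \<in> Qdes F
            then that i (forest_poly_rec (d - 1) (forest_quot (forest_quot F (Suc j)) i)) else 0)"
          using IH[OF True True] ij Qdes_forest_quot_below[OF True ij(2)] by simp
        finally show ?thesis using True by simp
      qed (simp add: g_def)
      show "(Var (X i) - Var (T i)) * delta j (Var (T (Suc j))) (g i) =
          (Var (X j) - Var (T (Suc j))) * delta i (Var (T i)) (g (Suc j))"
        unfolding L R using forest_quot_forest_quot[OF _ _ ij(2)] that_that[OF ij(2)]
        by (simp add: mult.left_commute)
    qed
  qed
  from someI_ex[OF this] show ?case by (simp add: g_def)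
qed

lemma forest_poly_family_exists:
  "forest_poly_family (\<lambda>F. forest_poly_rec (size (forest_rhos F)) F)"
  unfolding forest_poly_family_def
proof (intro allI impI)
  fix F assume F: "indexed_forest F"
  let ?P = "\<lambda>F. forest_poly_rec (size (forest_rhos F)) F"
  note props = forest_poly_rec_props[OF F refl]
  have "Ediv i (?P F) = (if i \<in> Qdes F then that i (?P (forest_quot F i)) else 0)" if "1 \<le> i" for i
    using props that size_forest_quot[OF F, of i] by auto
  moreover have "size (forest_rhos F) = 0 \<longleftrightarrow> F = empty_forest"
    using forest_rhos_empty_iff[OF F] by simp
  ultimately show "?P F \<in> poly_x \<and> homogeneous (?P F) \<and>
      eval_tt (?P F) = (if F = empty_forest then 1 else 0) \<and>
      (\<forall>i\<ge>1. Ediv i (?P F) = (if i \<in> Qdes F then that i (?P (forest_quot F i)) else 0))"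
    using props graded_homogeneous by auto
qed

section \<open>Uniqueness of the family\<close>

lemma poly_x_diff: "p \<in> poly_x \<Longrightarrow> q \<in> poly_x \<Longrightarrow> p - q \<in> poly_x"
  using vars_diff[of p q] by (force simp: poly_x_def)

lemma forest_poly_family_unique:
  assumes P: "forest_poly_family P" and Q: "forest_poly_family Q" and "indexed_forest F"
  shows "P F = Q F"
  using \<open>indexed_forest F\<close>
proof (induction "size (forest_rhos F)" arbitrary: F rule: less_induct)
  case less
  note PF = P[unfolded forest_poly_family_def, rule_format, OF less.prems]
  note QF = Q[unfolded forest_poly_family_def, rule_format, OF less.prems]
  have "P F - Q F = 0"
  proof (rule eq_0_of_Ediv_eq_0)
    show "P F - Q F \<in> poly_x" using PF QF poly_x_diff by blast
    show "eval_tt (P F - Q F) = 0" using PF QF by (simp add: eval_tt_def)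
    fix i :: nat assume i: "1 \<le> i"
    have "P (forest_quot F i) = Q (forest_quot F i)" if "i \<in> Qdes F"
      using less.hyps[of "forest_quot F i"] size_forest_quot indexed_forest_quot less.prems that by simp
    then show "Ediv i (P F - Q F) = 0" using PF QF i by (simp add: Ediv_diff)
  qed
  then show ?case by simp
qed

lemma forest_poly_eq:
  assumes "forest_poly_family P" "indexed_forest F"
  shows "forest_poly F = P F"
  unfolding forest_poly_def
  by (rule the_equality) (use assms forest_poly_family_unique in blast)+

lemma forest_poly_props:
  assumes "indexed_forest F"
  shows "forest_poly F \<in> poly_x"
    and "F \<noteq> empty_forest \<Longrightarrow> eval_tt (forest_poly F) = 0"
    and "1 \<le> i \<Longrightarrow> i \<notin> Qdes F \<Longrightarrow> Ediv i (forest_poly F) = 0"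
  using forest_poly_family_exists assms forest_poly_eq[OF forest_poly_family_exists assms]
  unfolding forest_poly_family_def by auto

text \<open>By \<open>Qdes_code\<close>, a terminal label i < n would require a positive entry
  followed by a zero, but in a padded composition the zeros come first.\<close>

lemma padded_comp_forest:
  assumes "padded_comp n c" "c \<noteq> replicate n 0"
  shows "forest_of_code c \<noteq> empty_forest" "Qdes (forest_of_code c) \<subseteq> {n}"
proof -
  let ?F = "forest_of_code c"
  have F: "indexed_forest ?F"
    and code: "code ?F i = (if 1 \<le> i \<and> i \<le> length c then c ! (i - 1) else 0)" for i
    using forest_of_code_props[of c] by (auto simp: fun_eq_iff)
  obtain k where len: "length c = n" and k: "\<And>i. i < k \<Longrightarrow> c ! i = 0"
      "\<And>i. k \<le> i \<Longrightarrow> i < n \<Longrightarrow> 0 < c ! i"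
    using assms(1) by (auto simp: padded_comp_def)
  show "?F \<noteq> empty_forest"
  proof
    assume "?F = empty_forest"
    then have "code ?F (Suc i) = 0" for i by (simp add: code_def empty_forest_def)
    then have "c ! i = 0" if "i < n" for i using that code[of "Suc i"] len by simp
    then have "c = replicate n 0" using len by (intro nth_equalityI) auto
    then show False using assms(2) by simp
  qed
  show "Qdes ?F \<subseteq> {n}"
  proof
    fix i assume "i \<in> Qdes ?F"
    \<comment> \<open>Codes are indexed from 1 and lists from 0, so labels i and i + 1 correspond to
      list positions i - 1 and i.\<close>
    from Qdes_code[OF F this] have i: "1 \<le> i" "i \<le> n" "0 < c ! (i - 1)" "i < n \<Longrightarrow> c ! i = 0"
      using code[of i] code[of "Suc i"] len by (auto split: if_splits)
    have "\<not> i < n"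
      using i k(1)[of "i - 1"] k(2)[of i] by fastforce
    then show "i \<in> {n}" using i by simp
  qed
qed

text \<open>Vanishing of E_i for i > n bounds the x-variables, and for i < n it is the symmetry
  condition.\<close>

lemma FF_EQSym:
  assumes "padded_comp n c" "c \<noteq> replicate n 0"
  shows "FF c \<in> EQSym n" "ev id (FF c) = 0"
proof -
  have F: "indexed_forest (forest_of_code c)" using forest_of_code_props by blast
  note props = forest_poly_props[OF F, folded FF_def]
  have E0: "Ediv i (FF c) = 0" if "1 \<le> i" "i \<noteq> n" for i
    using props(3) that padded_comp_forest(2)[OF assms] by blast
  have "FF c \<in> poly_xn n"
    by (rule poly_xn_of_Ediv_eq_0[OF props(1)]) (use E0 in auto)
  moreover have "Rplus i (FF c) = Rminus i (FF c)" if "1 \<le> i" "i < n" for i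
  proof -
    have "Rplus i (FF c) - Rminus i (FF c) = 0"
      using E0[of i] that by (simp add: Rdiff_eq_delta delta_eq_Ediv)
    then show ?thesis by simp
  qed
  ultimately show "FF c \<in> EQSym n" by (simp add: EQSym_def)
  show "ev id (FF c) = 0"
    using props(2) padded_comp_forest(1)[OF assms] by (simp add: eval_tt_eq_ev)
qed

theorem theorem7p1:
  fixes n :: nat
  assumes "1 \<le> n"
  shows "(\<forall>f \<sigma>. f \<in> EQSym n \<longrightarrow> \<sigma> \<in> NC n \<longrightarrow> ev \<sigma> f = ev id f)
       \<and> (\<forall>c \<sigma>. padded_comp n c \<longrightarrow> c \<noteq> replicate n 0 \<longrightarrow> \<sigma> \<in> NC n \<longrightarrow> ev \<sigma> (FF c) = 0)"
proof -
  have "ev \<sigma> f = ev id f" if "f \<in> EQSym n" "\<sigma> \<in> NC n" for f \<sigma>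
    using that ev_noncrossing by (auto simp: NC_def)
  then show ?thesis using FF_EQSym by metis
qed

end
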